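(* Let $1\le m\le n$, $N\ge 1$, let $\Omega\subseteq\mathbb{R}^n$ be a connected open set, let $X=\{X_1,\dots,X_m\}$ be a frame of vector fields with $X_i\in C^1(\Omega)^n$, and suppose $\Omega$ is equipped with a Riemannian metric $g$ which makes $X$ orthonormal. Let $u:\Omega\to\mathbb{R}^N$ be a map in $\Gamma^2_{rk}(\Omega)^N$. (1) If $u$ is a Horizontally $\infty$-Minimal Map with respect to the functional $E_\infty(u,\Omega)=\|Xu\|_{L^\infty(\Omega)}$, then $u$ solves the subelliptic $\infty$-Laplace system on $\Omega$: $$X_iu_\alpha\,X_ju_\beta\,X_iX_ju_\beta+\|Xu\|^2\,[Xu]^\bot_{\alpha\beta}\,X_iX_iu_\beta=0,\qquad \alpha=1,\dots,N.$$ (2) Conversely, if $\Omega$ is a Carnot-Carathéodory space with respect to $X$, $u\in\Gamma^2_{im}(\Omega)^N$, and $u$ solves the subelliptic $\infty$-Laplace system $$X_iu_\alpha\,X_ju_\beta\,X_iX_ju_\beta+\|Xu\|^2\,[Xu]^\bot_{\alpha\beta}\,X_iX_iu_\beta=0,\qquad \alpha=1,\dots,N,$$ on $\Omega$, then $u$ is a Horizontally $\infty$-Minimal Map with respect to $E_\infty$.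
   Context: Summation over repeated indices is used; Greek indices run over $1,\dots,N$, lowercase Latin over $1,\dots,m$, uppercase Latin over $1,\dots,n$. The horizontal subspace at $x$ is $H(x)=\mathrm{span}\{X_1(x),\dots,X_m(x)\}$. $X_iu(x)=\frac{d}{dt}\big|_{t=0}u(a(t))$ for a curve $a$ in $\Omega$ with $a(0)=x$, $a'(0)=X_i(x)$ (which may be taken to be $a(t)=x+tX_i(x)$). The horizontal gradient is $Xu=(X_iu_\alpha)\,e_\alpha\otimes X_i$, with $\|Xu\|^2=X_iu_\alpha X_iu_\alpha$; $\mathrm{rk}(Xu(x))$ is the rank of the $N\times m$ matrix $(X_iu_\alpha(x))$. $[Xu]^\bot(x)$ is the orthogonal projection of $\mathbb{R}^N$ onto the nullspace of the transpose $Xu(x)^\top:\mathbb{R}^N\to H(x)$, i.e. onto $\{\eta\in\mathbb{R}^N:\eta_\alpha X_iu_\alpha(x)=0\ \forall i\}$. Function classes: $\Gamma^1(\Omega)^N$ is the set of $u:\Omega\to\mathbb{R}^N$ with $u,X_iu\in C^0(\Omega)^N$ for all $i$. $\Gamma^2(\Omega)^N$ is the set of $u\in\Gamma^1(\Omega)^N$ such that, in addition, the Euclidean derivatives $D(X_iu)$ exist and lie in $C^0(\Omega)^{N\times n}$. For $k\in\{1,2\}$: $\Gamma^k_{im}(\Omega)^N=\{u\in\Gamma^k(\Omega)^N:\mathrm{rk}(Xu)\equiv m\le N\}$ (horizontal immersions), $\Gamma^k_{sb}(\Omega)^N=\{u\in\Gamma^k(\Omega)^N:\mathrm{rk}(Xu)\equiv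 N\le m\}$ (horizontal submersions), $\Gamma^k_{rk}(\Omega)^N=\Gamma^k_{im}(\Omega)^N\cup\Gamma^k_{sb}(\Omega)^N=\{u\in\Gamma^k(\Omega)^N:\mathrm{rk}(Xu)\equiv\min\{m,N\}\}$. For $D\Subset\Omega$, $\Gamma^1_0(D)$ is the set of functions $g\in C^0(\overline D)$ with $X_ig\in C^0(D)$ for all $i$ and $g=0$ on $\partial D$; $\Gamma^1(\overline D)$ is the set of functions $h$ with $h$ and all $X_ih$ continuous on $\overline D$. (Here $g$ denotes a function, not the metric.) For $D\subseteq\Omega$ open, $E_\infty(u,D)=\mathrm{ess\,sup}_D\|Xu\|$. A vertical vector field to $u$ over $D$ is a (horizontally $C^1$) map $\nu\in\Gamma^1(D)^N$ with $\nu(x)$ in the range of $[Xu]^\bot(x)$, i.e. $\nu_\alpha X_iu_\alpha=0$ for all $i$, on $D$; the set of these is $\Gamma([Xu]^\bot,D)$. Minimality: (i) $u\in\Gamma^1(\Omega)^N$ is Horizontal Rank-One Absolute Minimal on $\Omega$ if for every compactly contained subdomain $D\Subset\Omega$, every $g\in\Gamma^1_0(D)$ and every $\xi\in\mathbb{R}^N$ with Euclidean norm $|\xi|=1$, $E_\infty(u,D)\le E_\infty(u+g\xi,D)$. (ii) For $u\in\Gamma^1_{rk}(\Omega)^N$, $u(\Omega)$ has Horizontally $\infty$-Minimal Area if for every compactly contained subdomain $D\Subset\Omega$, every $h\in\Gamma^1(\overline D)$ and every $\nu\in\Gamma([Xu]^\bot,D)$, $E_\infty(u,D)\le E_\infty(u+h\nu,D)$.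 (iii) $u$ is a Horizontally $\infty$-Minimal Map with respect to $E_\infty$ if both (i) and (ii) hold. Carnot-Carathéodory space: an absolutely continuous curve $r:[0,T]\to\Omega$ is admissible if there are measurable $a_i:[0,T]\to\mathbb{R}$ with $r'(t)=a_i(t)X_i(r(t))$ and $a_i(t)a_i(t)\le1$ for a.e. $t\in[0,T]$. $\Omega$ is a Carnot-Carathéodory space (with respect to $X$) if any two points of $\Omega$ can be joined by an admissible curve lying in $\Omega$. *)

theory Defs
  imports "HOL-Analysis.Analysis" "HOL-Probability.Essential_Supremum"
begin

(* The indices 1..n, 1..m, 1..N are the finite types 'n, 'm, 'N; a frame is a family
   X :: 'm => real^'n => real^'n, and maps on an open set are total functions whose values
   outside that set play no role. *)

definition C1_on ::
  "'a::real_normed_vector set \<Rightarrow> ('a \<Rightarrow> 'b::real_normed_vector) \<Rightarrow> bool" where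
  "C1_on S f \<longleftrightarrow> (\<exists>f'. (\<forall>x\<in>S. (f has_derivative blinfun_apply (f' x)) (at x)) \<and> continuous_on S f')"

(* The metric enters only through orthonormality of the C^1 frame; mere continuity of its
   coefficients is required, so every C^k or smooth metric is covered. *)
definition riemannian_metric_on :: "(real^'n) set \<Rightarrow> (real^'n \<Rightarrow> real^'n^'n) \<Rightarrow> bool" where
  "riemannian_metric_on \<Omega> G \<longleftrightarrow> continuous_on \<Omega> G \<and>
     (\<forall>x\<in>\<Omega>. transpose (G x) = G x \<and> (\<forall>v. v \<noteq> 0 \<longrightarrow> v \<bullet> (G x *v v) > 0))"

definition orthonormal_frame_on ::
  "(real^'n) set \<Rightarrow> (real^'n \<Rightarrow> real^'n^'n) \<Rightarrow> ('m::finite \<Rightarrow> real^'n \<Rightarrow> real^'n) \<Rightarrow> bool" where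
  "orthonormal_frame_on \<Omega> G X \<longleftrightarrow>
     (\<forall>x\<in>\<Omega>. \<forall>i j. X i x \<bullet> (G x *v X j x) = (if i = j then 1 else 0))"

(* Derivative along the straight line t |-> x + t V(x); no Euclidean differentiability of u
   is presupposed. *)
definition hderivable ::
  "('a::real_normed_vector \<Rightarrow> 'a) \<Rightarrow> ('a \<Rightarrow> 'b::real_normed_vector) \<Rightarrow> 'a \<Rightarrow> bool" where
  "hderivable V u x \<longleftrightarrow> (\<lambda>t::real. u (x + t *\<^sub>R V x)) differentiable (at 0)"

definition hderiv ::
  "('a::real_normed_vector \<Rightarrow> 'a) \<Rightarrow> ('a \<Rightarrow> 'b::real_normed_vector) \<Rightarrow> 'a \<Rightarrow> 'b" where
  "hderiv V u x = vector_derivative (\<lambda>t::real. u (x + t *\<^sub>R V x)) (at 0)"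

(* N x m matrix with entry X_i u_alpha in row alpha, column i. The norm of the type real^'m^'N
   is the Frobenius norm, so norm (hgrad X u x)^2 is the sum of all (X_i u_alpha)^2. *)
definition hgrad ::
  "('m::finite \<Rightarrow> real^'n \<Rightarrow> real^'n) \<Rightarrow> (real^'n \<Rightarrow> real^'N) \<Rightarrow> real^'n \<Rightarrow> real^'m^'N" where
  "hgrad X u x = (\<chi> \<alpha> i. hderiv (X i) u x $ \<alpha>)"

definition orth_proj :: "'a::real_inner set \<Rightarrow> 'a \<Rightarrow> 'a" where
  "orth_proj S y = (THE z. z \<in> S \<and> (\<forall>w\<in>S. orthogonal (y - z) w))"

definition perp_proj ::
  "('m::finite \<Rightarrow> real^'n \<Rightarrow> real^'n) \<Rightarrow> (real^'n \<Rightarrow> real^'N) \<Rightarrow> real^'n \<Rightarrow> real^'N^'N" where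
  "perp_proj X u x = matrix (orth_proj {\<eta>. transpose (hgrad X u x) *v \<eta> = 0})"

definition Gamma1 ::
  "('m::finite \<Rightarrow> real^'n \<Rightarrow> real^'n) \<Rightarrow> (real^'n) set \<Rightarrow> (real^'n \<Rightarrow> 'b::real_normed_vector) set" where
  "Gamma1 X \<Omega> = {u. continuous_on \<Omega> u \<and>
     (\<forall>i. (\<forall>x\<in>\<Omega>. hderivable (X i) u x) \<and> continuous_on \<Omega> (hderiv (X i) u))}"

definition Gamma2 ::
  "('m::finite \<Rightarrow> real^'n \<Rightarrow> real^'n) \<Rightarrow> (real^'n) set \<Rightarrow> (real^'n \<Rightarrow> 'b::real_normed_vector) set" where
  "Gamma2 X \<Omega> = {u \<in> Gamma1 X \<Omega>. \<forall>i. C1_on \<Omega> (hderiv (X i) u)}"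

definition h_immersions ::
  "('m::finite \<Rightarrow> real^'n \<Rightarrow> real^'n) \<Rightarrow> (real^'n) set \<Rightarrow> (real^'n \<Rightarrow> real^'N) set" where
  "h_immersions X \<Omega> = {u. CARD('m) \<le> CARD('N) \<and> (\<forall>x\<in>\<Omega>. rank (hgrad X u x) = CARD('m))}"

definition h_submersions ::
  "('m::finite \<Rightarrow> real^'n \<Rightarrow> real^'n) \<Rightarrow> (real^'n) set \<Rightarrow> (real^'n \<Rightarrow> real^'N) set" where
  "h_submersions X \<Omega> = {u. CARD('N) \<le> CARD('m) \<and> (\<forall>x\<in>\<Omega>. rank (hgrad X u x) = CARD('N))}"

definition Gamma1_rk ::
  "('m::finite \<Rightarrow> real^'n \<Rightarrow> real^'n) \<Rightarrow> (real^'n) set \<Rightarrow> (real^'n \<Rightarrow> real^'N) set" where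
  "Gamma1_rk X \<Omega> = (Gamma1 X \<Omega> \<inter> h_immersions X \<Omega>) \<union> (Gamma1 X \<Omega> \<inter> h_submersions X \<Omega>)"

definition Gamma2_im ::
  "('m::finite \<Rightarrow> real^'n \<Rightarrow> real^'n) \<Rightarrow> (real^'n) set \<Rightarrow> (real^'n \<Rightarrow> real^'N) set" where
  "Gamma2_im X \<Omega> = Gamma2 X \<Omega> \<inter> h_immersions X \<Omega>"

definition Gamma2_sb ::
  "('m::finite \<Rightarrow> real^'n \<Rightarrow> real^'n) \<Rightarrow> (real^'n) set \<Rightarrow> (real^'n \<Rightarrow> real^'N) set" where
  "Gamma2_sb X \<Omega> = Gamma2 X \<Omega> \<inter> h_submersions X \<Omega>"

definition Gamma2_rk ::
  "('m::finite \<Rightarrow> real^'n \<Rightarrow> real^'n) \<Rightarrow> (real^'n) set \<Rightarrow> (real^'n \<Rightarrow> real^'N) set" where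
  "Gamma2_rk X \<Omega> = Gamma2_im X \<Omega> \<union> Gamma2_sb X \<Omega>"

definition Gamma1_0 ::
  "('m::finite \<Rightarrow> real^'n \<Rightarrow> real^'n) \<Rightarrow> (real^'n) set \<Rightarrow> (real^'n \<Rightarrow> real) set" where
  "Gamma1_0 X D = {g. continuous_on (closure D) g \<and>
     (\<forall>i. (\<forall>x\<in>D. hderivable (X i) g x) \<and> continuous_on D (hderiv (X i) g)) \<and>
     (\<forall>x\<in>frontier D. g x = 0)}"

(* Continuity of X_i h on the closure means that X_i h, defined on D, extends continuously
   to the closure: at boundary points the straight line may leave the closure of D. *)
definition Gamma1_closure ::
  "('m::finite \<Rightarrow> real^'n \<Rightarrow> real^'n) \<Rightarrow> (real^'n) set \<Rightarrow> (real^'n \<Rightarrow> real) set" where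
  "Gamma1_closure X D = {h. continuous_on (closure D) h \<and>
     (\<forall>i. (\<forall>x\<in>D. hderivable (X i) h x) \<and>
          (\<exists>k. continuous_on (closure D) k \<and> (\<forall>x\<in>D. k x = hderiv (X i) h x)))}"

definition E_inf ::
  "('m::finite \<Rightarrow> real^'n \<Rightarrow> real^'n) \<Rightarrow> (real^'n \<Rightarrow> real^'N) \<Rightarrow> (real^'n) set \<Rightarrow> ereal" where
  "E_inf X u D = esssup (lebesgue_on D) (\<lambda>x. ereal (norm (hgrad X u x)))"

definition vertical_fields ::
  "('m::finite \<Rightarrow> real^'n \<Rightarrow> real^'n) \<Rightarrow> (real^'n \<Rightarrow> real^'N) \<Rightarrow> (real^'n) set \<Rightarrow> (real^'n \<Rightarrow> real^'N) set" where
  "vertical_fields X u D =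
     {\<nu> \<in> Gamma1 X D. \<forall>x\<in>D. \<nu> x \<in> range (\<lambda>\<eta>. perp_proj X u x *v \<eta>)}"

definition compact_subdomain :: "'a::metric_space set \<Rightarrow> 'a set \<Rightarrow> bool" where
  "compact_subdomain D \<Omega> \<longleftrightarrow>
     open D \<and> connected D \<and> D \<noteq> {} \<and> compact (closure D) \<and> closure D \<subseteq> \<Omega>"

definition h_rank_one_absolute_minimal ::
  "('m::finite \<Rightarrow> real^'n \<Rightarrow> real^'n) \<Rightarrow> (real^'n) set \<Rightarrow> (real^'n \<Rightarrow> real^'N) \<Rightarrow> bool" where
  "h_rank_one_absolute_minimal X \<Omega> u \<longleftrightarrow> u \<in> Gamma1 X \<Omega> \<and>
     (\<forall>D. compact_subdomain D \<Omega> \<longrightarrow> (\<forall>g\<in>Gamma1_0 X D. \<forall>\<xi>. norm \<xi> = 1 \<longrightarrow>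
        E_inf X u D \<le> E_inf X (\<lambda>x. u x + g x *\<^sub>R \<xi>) D))"

definition h_inf_minimal_area ::
  "('m::finite \<Rightarrow> real^'n \<Rightarrow> real^'n) \<Rightarrow> (real^'n) set \<Rightarrow> (real^'n \<Rightarrow> real^'N) \<Rightarrow> bool" where
  "h_inf_minimal_area X \<Omega> u \<longleftrightarrow> u \<in> Gamma1_rk X \<Omega> \<and>
     (\<forall>D. compact_subdomain D \<Omega> \<longrightarrow> (\<forall>h\<in>Gamma1_closure X D. \<forall>\<nu>\<in>vertical_fields X u D.
        E_inf X u D \<le> E_inf X (\<lambda>x. u x + h x *\<^sub>R \<nu> x) D))"

definition h_inf_minimal_map ::
  "('m::finite \<Rightarrow> real^'n \<Rightarrow> real^'n) \<Rightarrow> (real^'n) set \<Rightarrow> (real^'n \<Rightarrow> real^'N) \<Rightarrow> bool" where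
  "h_inf_minimal_map X \<Omega> u \<longleftrightarrow> h_rank_one_absolute_minimal X \<Omega> u \<and> h_inf_minimal_area X \<Omega> u"

definition solves_inf_laplace ::
  "('m::finite \<Rightarrow> real^'n \<Rightarrow> real^'n) \<Rightarrow> (real^'n) set \<Rightarrow> (real^'n \<Rightarrow> real^'N) \<Rightarrow> bool" where
  "solves_inf_laplace X \<Omega> u \<longleftrightarrow> (\<forall>x\<in>\<Omega>. \<forall>\<alpha>.
     (\<Sum>i\<in>UNIV. \<Sum>j\<in>UNIV. \<Sum>\<beta>\<in>UNIV.
        hgrad X u x $ \<alpha> $ i * hgrad X u x $ \<beta> $ j * hderiv (X i) (hderiv (X j) u) x $ \<beta>)
     + (norm (hgrad X u x))\<^sup>2 *
       (\<Sum>\<beta>\<in>UNIV. \<Sum>i\<in>UNIV. perp_proj X u x $ \<alpha> $ \<beta> * hderiv (X i) (hderiv (X i) u) x $ \<beta>) = 0)"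

definition absolutely_continuous_curve ::
  "real \<Rightarrow> real \<Rightarrow> (real \<Rightarrow> 'a::real_normed_vector) \<Rightarrow> bool" where
  "absolutely_continuous_curve a b r \<longleftrightarrow> (\<forall>e>0. \<exists>d>0. \<forall>I::(real \<times> real) set.
     finite I \<and> (\<forall>(s, t)\<in>I. a \<le> s \<and> s < t \<and> t \<le> b) \<and>
     pairwise (\<lambda>(s, t) (s', t'). disjnt {s<..<t} {s'<..<t'}) I \<and> (\<Sum>(s, t)\<in>I. t - s) < d
     \<longrightarrow> (\<Sum>(s, t)\<in>I. norm (r t - r s)) < e)"

definition admissible_curve ::
  "('m::finite \<Rightarrow> real^'n \<Rightarrow> real^'n) \<Rightarrow> (real^'n) set \<Rightarrow> real \<Rightarrow> (real \<Rightarrow> real^'n) \<Rightarrow> bool" where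
  "admissible_curve X \<Omega> T r \<longleftrightarrow> 0 \<le> T \<and> r ` {0..T} \<subseteq> \<Omega> \<and> absolutely_continuous_curve 0 T r \<and>
     (\<exists>a::'m \<Rightarrow> real \<Rightarrow> real. (\<forall>i. a i \<in> borel_measurable (lebesgue_on {0..T})) \<and>
        (AE t in lebesgue_on {0..T}.
           (r has_vector_derivative (\<Sum>i\<in>UNIV. a i t *\<^sub>R X i (r t))) (at t within {0..T}) \<and>
           (\<Sum>i\<in>UNIV. a i t * a i t) \<le> 1))"

definition carnot_caratheodory ::
  "('m::finite \<Rightarrow> real^'n \<Rightarrow> real^'n) \<Rightarrow> (real^'n) set \<Rightarrow> bool" where
  "carnot_caratheodory X \<Omega> \<longleftrightarrow>
     (\<forall>x\<in>\<Omega>. \<forall>y\<in>\<Omega>. \<exists>T r. admissible_curve X \<Omega> T r \<and> r 0 = x \<and> r T = y)"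

end

theory Submission
  imports Defs
begin

text \<open>
The system has two terms, the tangential one \<open>X\<^sub>i(|Xu|\<^sup>2 / 2) X\<^sub>iu\<close> in the span of the vectors
\<open>X\<^sub>iu\<close> and the normal one \<open>|Xu|\<^sup>2 [Xu]\<^sup>\<bottom> X\<^sub>iX\<^sub>iu\<close> orthogonal to it. Rank-one minimality controls
the first and minimality of area the second.

Suppose that \<open>u\<close> is minimal. Comparing \<open>u\<close> on a small ball with \<open>u + g\<xi>\<close>, where \<open>g\<close> is a flat
paraboloid vanishing on the sphere, changes the gradient of \<open>|Xu|\<^sup>2\<close> at the centre by an arbitrary
multiple of \<open>(X\<^sub>iu \<bullet> \<xi>) X\<^sub>i\<close>. As the supremum over the ball grows to first order like the norm of
this gradient, minimality forces the derivative of \<open>|Xu|\<^sup>2\<close> in that direction to be zero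
(\<open>rank_one_minimal_imp_tangential\<close>). For the normal term, let \<open>\<nu>\<close> be a vertical field. From
\<open>X\<^sub>iu \<bullet> \<nu> = 0\<close> one gets \<open>X\<^sub>iu \<bullet> X\<^sub>i\<nu> = - \<nu> \<bullet> X\<^sub>iX\<^sub>iu\<close>, so that for constant \<open>\<delta>\<close>
\<open>|X(u + \<delta>\<nu>)|\<^sup>2 = |Xu|\<^sup>2 - 2\<delta> \<nu> \<bullet> X\<^sub>iX\<^sub>iu + \<delta>\<^sup>2|X\<nu>|\<^sup>2\<close>, and a nonzero normal part of
\<open>X\<^sub>iX\<^sub>iu\<close> would allow the energy to be lowered uniformly on a ball
(\<open>minimal_area_imp_normal_nonpos\<close>). For submersions there is no normal part.

Conversely, let the immersion \<open>u\<close> solve the system. By orthogonality both terms vanish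
(\<open>immersion_solution_splits\<close>), so all horizontal derivatives of \<open>|Xu|\<^sup>2\<close> are zero. Then \<open>|Xu|\<close> is
constant along admissible curves, and these connect any two points of \<open>\<Omega>\<close>. A perturbation \<open>g\<xi>\<close> leaves the gradient
unchanged at a critical point of \<open>g\<close>, and a vertical perturbation does not decrease its norm at any
point, by the displayed identity with \<open>\<delta>\<nu>\<close> replaced by \<open>h\<nu>\<close>. Either way the supremum cannot
drop below the constant.
\<close>

section \<open>Continuously differentiable maps\<close>

lemma C1_on_imp_continuous_on: "C1_on S f \<Longrightarrow> continuous_on S f"
  unfolding C1_on_def
  by (meson continuous_at_imp_continuous_on has_derivative_continuous)

lemma C1_on_has_derivative:
  "C1_on S f \<Longrightarrow> x \<in> S \<Longrightarrow> (f has_derivative frechet_derivative f (at x)) (at x)"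
  unfolding C1_on_def by (metis frechet_derivative_works differentiableI)

lemma C1_on_const: "C1_on S (\<lambda>x. c)"
  unfolding C1_on_def by (rule exI[of _ "\<lambda>x. 0"]) (auto simp: zero_blinfun.rep_eq)

lemma C1_on_add: "C1_on S f \<Longrightarrow> C1_on S g \<Longrightarrow> C1_on S (\<lambda>x. f x + g x)"
  unfolding C1_on_def
proof (elim exE conjE)
  fix f' g'
  assume "\<forall>x\<in>S. (f has_derivative blinfun_apply (f' x)) (at x)"
    "\<forall>x\<in>S. (g has_derivative blinfun_apply (g' x)) (at x)"
    "continuous_on S f'" "continuous_on S g'"
  then show "\<exists>h'. (\<forall>x\<in>S. ((\<lambda>x. f x + g x) has_derivative blinfun_apply (h' x)) (at x))
      \<and> continuous_on S h'"
    by (intro exI[of _ "\<lambda>x. f' x + g' x"])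
      (auto simp: plus_blinfun.rep_eq intro!: continuous_intros has_derivative_add)
qed

lemma C1_on_bounded_linear:
  assumes "bounded_linear L" "C1_on S f"
  shows "C1_on S (\<lambda>x. L (f x))"
proof -
  obtain f' where f': "\<forall>x\<in>S. (f has_derivative blinfun_apply (f' x)) (at x)" "continuous_on S f'"
    using assms unfolding C1_on_def by blast
  show ?thesis
    unfolding C1_on_def
  proof (intro exI[of _ "\<lambda>x. Blinfun L o\<^sub>L f' x"] conjI ballI)
    fix x assume "x \<in> S"
    then have "((\<lambda>x. L (f x)) has_derivative (\<lambda>v. L (f' x v))) (at x)"
      using f' assms(1) by (blast intro: bounded_linear.has_derivative)
    then show "((\<lambda>x. L (f x)) has_derivative blinfun_apply (Blinfun L o\<^sub>L f' x)) (at x)"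
      by (simp add: blinfun_apply_blinfun_compose[abs_def] bounded_linear_Blinfun_apply assms(1)
          comp_def)
  next
    show "continuous_on S (\<lambda>x. Blinfun L o\<^sub>L f' x)"
      by (intro bounded_bilinear.continuous_on[OF bounded_bilinear_blinfun_compose]
          continuous_on_const f'(2))
  qed
qed

lemma C1_on_mult:
  fixes f g :: "'a::real_normed_vector \<Rightarrow> real"
  assumes "C1_on S f" "C1_on S g"
  shows "C1_on S (\<lambda>x. f x * g x)"
proof -
  obtain f' where f': "\<forall>x\<in>S. (f has_derivative blinfun_apply (f' x)) (at x)" "continuous_on S f'"
    using assms unfolding C1_on_def by blast
  obtain g' where g': "\<forall>x\<in>S. (g has_derivative blinfun_apply (g' x)) (at x)" "continuous_on S g'"
    using assms unfolding C1_on_def by blast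
  have "((\<lambda>x. f x * g x) has_derivative blinfun_apply (f x *\<^sub>R g' x + g x *\<^sub>R f' x)) (at x)"
    if "x \<in> S" for x
  proof -
    have "((\<lambda>x. f x * g x) has_derivative (\<lambda>h. f x * g' x h + f' x h * g x)) (at x)"
      using f' g' that by (intro has_derivative_mult) auto
    then show ?thesis
      by (simp add: plus_blinfun.rep_eq scaleR_blinfun.rep_eq mult.commute)
  qed
  moreover have "continuous_on S (\<lambda>x. f x *\<^sub>R g' x + g x *\<^sub>R f' x)"
    by (intro continuous_intros f'(2) g'(2) assms[THEN C1_on_imp_continuous_on])
  ultimately show ?thesis
    unfolding C1_on_def by (intro exI[of _ "\<lambda>x. f x *\<^sub>R g' x + g x *\<^sub>R f' x"]) simp
qed

text \<open>
Together with sums and products this makes the entries of an inverse matrix, written by Cramer's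
rule as quotients of determinants, \<open>C\<^sup>1\<close> functions.
\<close>

lemma C1_on_inverse:
  fixes f :: "'a::real_normed_vector \<Rightarrow> real"
  assumes "C1_on S f" "\<And>x. x \<in> S \<Longrightarrow> f x \<noteq> 0"
  shows "C1_on S (\<lambda>x. inverse (f x))"
proof -
  obtain f' where f': "\<forall>x\<in>S. (f has_derivative blinfun_apply (f' x)) (at x)" "continuous_on S f'"
    using assms unfolding C1_on_def by blast
  have "((\<lambda>x. inverse (f x)) has_derivative
      blinfun_apply (- (inverse (f x) * inverse (f x)) *\<^sub>R f' x)) (at x)"
    if "x \<in> S" for x
  proof -
    have "((\<lambda>x. inverse (f x)) has_derivative (\<lambda>h. - (inverse (f x) * f' x h * inverse (f x)))) (at x)"
      using f'(1) assms(2) that by (blast intro: Deriv.has_derivative_inverse)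
    then show ?thesis
      by (simp add: scaleR_blinfun.rep_eq uminus_blinfun.rep_eq mult_ac)
  qed
  moreover have "continuous_on S (\<lambda>x. - (inverse (f x) * inverse (f x)) *\<^sub>R f' x)"
    using assms(2) by (intro continuous_intros f'(2) assms(1)[THEN C1_on_imp_continuous_on]) auto
  ultimately show ?thesis
    unfolding C1_on_def
    by (intro exI[of _ "\<lambda>x. - (inverse (f x) * inverse (f x)) *\<^sub>R f' x"]) simp
qed

lemma C1_on_sum:
  "(\<And>k. k \<in> K \<Longrightarrow> C1_on S (f k)) \<Longrightarrow> C1_on S (\<lambda>x. \<Sum>k\<in>K. f k x)"
  by (induction K rule: infinite_finite_induct) (auto intro: C1_on_const C1_on_add)

lemma C1_on_prod:
  fixes f :: "'k \<Rightarrow> 'a::real_normed_vector \<Rightarrow> real"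
  shows "(\<And>k. k \<in> K \<Longrightarrow> C1_on S (f k)) \<Longrightarrow> C1_on S (\<lambda>x. \<Prod>k\<in>K. f k x)"
  by (induction K rule: infinite_finite_induct) (auto intro: C1_on_const C1_on_mult)

lemma C1_on_vec_nth: "C1_on S f \<Longrightarrow> C1_on S (\<lambda>x. f x $ k)"
  by (rule C1_on_bounded_linear[OF bounded_linear_vec_nth])

lemma C1_on_vec_lambda:
  fixes f :: "'a::real_normed_vector \<Rightarrow> real^'k"
  assumes "\<And>k. C1_on S (\<lambda>x. f x $ k)"
  shows "C1_on S f"
proof -
  have "f = (\<lambda>x. \<Sum>k\<in>UNIV. f x $ k *\<^sub>R axis k 1)"
    by (simp add: fun_eq_iff vec_eq_iff axis_def if_distrib cong: if_cong)
  moreover have "C1_on S (\<lambda>x. \<Sum>k\<in>UNIV. f x $ k *\<^sub>R axis k (1::real))"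
    by (intro C1_on_sum C1_on_bounded_linear[OF bounded_linear_scaleR_left] assms)
  ultimately show ?thesis by simp
qed

lemma C1_on_det:
  fixes A :: "'a::real_normed_vector \<Rightarrow> real^'k^'k"
  assumes "\<And>i j. C1_on S (\<lambda>x. A x $ i $ j)"
  shows "C1_on S (\<lambda>x. det (A x))"
  unfolding det_def
  by (intro C1_on_sum C1_on_mult C1_on_const C1_on_prod assms)

section \<open>Horizontal derivatives\<close>

lemma hderivable_iff_has_vector_derivative:
  "hderivable V u x \<longleftrightarrow>
     ((\<lambda>t. u (x + t *\<^sub>R V x)) has_vector_derivative hderiv V u x) (at 0)"
  unfolding hderivable_def hderiv_def by (rule vector_derivative_works)

lemma hderiv_eqI:
  assumes "((\<lambda>t. u (x + t *\<^sub>R V x)) has_vector_derivative d) (at 0)"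
  shows "hderivable V u x" "hderiv V u x = d"
  using assms unfolding hderivable_def hderiv_def
  by (auto intro: differentiableI_vector vector_derivative_at)

text \<open>
Horizontal derivatives are taken along straight lines, so where a Euclidean derivative exists they
are its values on the frame vectors. For \<open>u\<close> itself no Euclidean derivative is available, which
is why the sum and product rules below are proved separately for horizontal derivatives.
\<close>

lemma hderiv_has_derivative:
  assumes "(u has_derivative u') (at x)"
  shows "hderivable V u x" "hderiv V u x = u' (V x)"
proof -
  have "((\<lambda>t. u (x + t *\<^sub>R V x)) has_derivative (\<lambda>t. u' (t *\<^sub>R V x))) (at 0)"
    by (rule has_derivative_compose[where g = u])
      (use assms in \<open>auto intro!: derivative_eq_intros\<close>)
  moreover have "u' (t *\<^sub>R V x) = t *\<^sub>R u' (V x)" for t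
    using assms by (simp add: has_derivative_def bounded_linear.axioms(1) linear_simps)
  ultimately have "((\<lambda>t. u (x + t *\<^sub>R V x)) has_vector_derivative u' (V x)) (at 0)"
    by (simp add: has_vector_derivative_def)
  then show "hderivable V u x" "hderiv V u x = u' (V x)"
    using hderiv_eqI[of u x V] by blast+
qed

lemma hderiv_add:
  assumes "hderivable V f x" "hderivable V g x"
  shows "hderivable V (\<lambda>x. f x + g x) x"
    "hderiv V (\<lambda>x. f x + g x) x = hderiv V f x + hderiv V g x"
  using has_vector_derivative_add[OF assms[unfolded hderivable_iff_has_vector_derivative]]
  by (auto dest: hderiv_eqI[where u = "\<lambda>x. f x + g x"])

lemma hderiv_bilinear:
  assumes "bounded_bilinear p" "hderivable V f x" "hderivable V g x"
  shows "hderivable V (\<lambda>x. p (f x) (g x)) x"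
    "hderiv V (\<lambda>x. p (f x) (g x)) x = p (f x) (hderiv V g x) + p (hderiv V f x) (g x)"
  using bounded_bilinear.has_vector_derivative
      [OF assms(1) assms(2,3)[unfolded hderivable_iff_has_vector_derivative]]
  by (auto dest: hderiv_eqI[where u = "\<lambda>x. p (f x) (g x)"])

lemma hderiv_locally_constant:
  assumes "open D" "x \<in> D" "\<And>y. y \<in> D \<Longrightarrow> f y = c"
  shows "hderiv V f x = 0"
proof -
  have "(f has_derivative (\<lambda>h. 0)) (at x)"
    by (rule has_derivative_transform_within_open[OF has_derivative_const[of c] assms(1,2)])
      (simp add: assms(3))
  from hderiv_has_derivative(2)[OF this, of V] show ?thesis by simp
qed

lemma hderiv_local_extremum:
  fixes g :: "'a::real_normed_vector \<Rightarrow> real"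
  assumes "open D" "x \<in> D" "hderivable V g x"
    and ext: "(\<forall>y\<in>D. g y \<le> g x) \<or> (\<forall>y\<in>D. g x \<le> g y)"
  shows "hderiv V g x = 0"
proof -
  define S where "S = (\<lambda>t. x + t *\<^sub>R V x) -` D"
  have "open S"
    unfolding S_def by (intro open_vimage assms continuous_intros)
  moreover have "0 \<in> S"
    using assms by (simp add: S_def)
  moreover have "((\<lambda>t. g (x + t *\<^sub>R V x)) has_derivative (\<lambda>t. t *\<^sub>R hderiv V g x)) (at 0)"
    using assms(3) by (simp add: hderivable_iff_has_vector_derivative has_vector_derivative_def)
  moreover have "(\<forall>t\<in>S. g (x + t *\<^sub>R V x) \<le> g (x + 0 *\<^sub>R V x))
      \<or> (\<forall>t\<in>S. g (x + 0 *\<^sub>R V x) \<le> g (x + t *\<^sub>R V x))"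
    using ext by (auto simp: S_def)
  ultimately have "(\<lambda>t. t *\<^sub>R hderiv V g x) = (\<lambda>t. 0)"
    by (intro differential_zero_maxmin[of 0 S "\<lambda>t. g (x + t *\<^sub>R V x)"])
  from fun_cong[OF this, of 1] show ?thesis by simp
qed

section \<open>The spaces of horizontally differentiable maps\<close>

lemma Gamma1_mono: "v \<in> Gamma1 X S \<Longrightarrow> D \<subseteq> S \<Longrightarrow> v \<in> Gamma1 X D"
  unfolding Gamma1_def by (auto intro: continuous_on_subset)

lemma Gamma1_add:
  assumes "f \<in> Gamma1 X D" "g \<in> Gamma1 X D"
  shows "(\<lambda>x. f x + g x) \<in> Gamma1 X D"
proof -
  have "continuous_on D (hderiv (X i) (\<lambda>x. f x + g x))" for i
  proof -
    have "continuous_on D (\<lambda>x. hderiv (X i) f x + hderiv (X i) g x)"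
      using assms by (auto simp: Gamma1_def intro!: continuous_intros)
    then show ?thesis
      using assms by (auto simp: Gamma1_def hderiv_add(2) cong: continuous_on_cong)
  qed
  then show ?thesis
    using assms by (auto simp: Gamma1_def hderiv_add intro!: continuous_intros)
qed

lemma Gamma1_scaleR:
  assumes "h \<in> Gamma1 X D" "\<nu> \<in> Gamma1 X D"
  shows "(\<lambda>x. h x *\<^sub>R \<nu> x) \<in> Gamma1 X D"
proof -
  note hd = hderiv_bilinear[OF bounded_bilinear_scaleR]
  have "continuous_on D (hderiv (X i) (\<lambda>x. h x *\<^sub>R \<nu> x))" for i
  proof -
    have "continuous_on D (\<lambda>x. h x *\<^sub>R hderiv (X i) \<nu> x + hderiv (X i) h x *\<^sub>R \<nu> x)"
      using assms by (auto simp: Gamma1_def intro!: continuous_intros)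
    then show ?thesis
      using assms by (auto simp: Gamma1_def hd(2) cong: continuous_on_cong)
  qed
  then show ?thesis
    using assms by (auto simp: Gamma1_def hd intro!: continuous_intros)
qed

lemma C1_on_imp_Gamma1:
  assumes "C1_on D f" "\<And>i. continuous_on D (X i)"
  shows "f \<in> Gamma1 X D"
proof -
  obtain f' where f': "\<And>x. x \<in> D \<Longrightarrow> (f has_derivative blinfun_apply (f' x)) (at x)"
    "continuous_on D f'"
    using assms unfolding C1_on_def by blast
  have "continuous_on D (hderiv (X i) f)" for i
  proof -
    have "continuous_on D (\<lambda>x. f' x (X i x))"
      using assms f' by (auto intro!: continuous_intros)
    then show ?thesis
      using hderiv_has_derivative(2)[OF f'(1)] by (simp cong: continuous_on_cong)
  qed
  then show ?thesis
    unfolding Gamma1_def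
    using hderiv_has_derivative(1)[OF f'(1)] C1_on_imp_continuous_on[OF assms(1)] by auto
qed

lemma Gamma1_const: "(\<lambda>x. c) \<in> Gamma1 X D"
proof -
  note hd = hderiv_has_derivative[OF has_derivative_const]
  show ?thesis
    by (auto simp: Gamma1_def hd continuous_on_const cong: continuous_on_cong)
qed

lemma Gamma1_0_imp_Gamma1: "g \<in> Gamma1_0 X D \<Longrightarrow> g \<in> Gamma1 X D"
  unfolding Gamma1_0_def Gamma1_def using closure_subset by (auto intro: continuous_on_subset)

lemma Gamma1_closure_imp_Gamma1: "h \<in> Gamma1_closure X D \<Longrightarrow> h \<in> Gamma1 X D"
proof -
  assume h: "h \<in> Gamma1_closure X D"
  have "continuous_on D (hderiv (X i) h)" for i
  proof -
    obtain k where k: "continuous_on (closure D) k" "\<forall>x\<in>D. k x = hderiv (X i) h x"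
      using h unfolding Gamma1_closure_def by blast
    show ?thesis
      by (rule continuous_on_eq[OF continuous_on_subset[OF k(1) closure_subset]]) (use k(2) in blast)
  qed
  then show ?thesis
    using h closure_subset unfolding Gamma1_closure_def Gamma1_def
    by (auto intro: continuous_on_subset)
qed

section \<open>The horizontal gradient and its supremum\<close>

lemma continuous_on_hgrad:
  assumes "v \<in> Gamma1 X D"
  shows "continuous_on D (hgrad X v)"
  unfolding hgrad_def
  using assms
  by (intro continuous_on_vec_lambda continuous_on_component) (simp add: Gamma1_def)

lemma inner_hgrad:
  "hgrad X v x \<bullet> hgrad X w x = (\<Sum>i\<in>UNIV. hderiv (X i) v x \<bullet> hderiv (X i) w x)"
  unfolding inner_vec_def hgrad_def by (simp, rule sum.swap)

lemma norm_hgrad_eq: "(norm (hgrad X v x))\<^sup>2 = (\<Sum>i\<in>UNIV. hderiv (X i) v x \<bullet> hderiv (X i) v x)"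
  by (simp add: inner_hgrad power2_norm_eq_inner)

lemma hgrad_add:
  assumes "v \<in> Gamma1 X D" "w \<in> Gamma1 X D" "x \<in> D"
  shows "hgrad X (\<lambda>x. v x + w x) x = hgrad X v x + hgrad X w x"
  using assms by (simp add: hgrad_def hderiv_add(2) Gamma1_def vec_eq_iff)

lemma norm_hgrad_add:
  assumes "v \<in> Gamma1 X D" "w \<in> Gamma1 X D" "x \<in> D"
  shows "(norm (hgrad X (\<lambda>x. v x + w x) x))\<^sup>2 = (norm (hgrad X v x))\<^sup>2
    + 2 * (\<Sum>i\<in>UNIV. hderiv (X i) v x \<bullet> hderiv (X i) w x) + (norm (hgrad X w x))\<^sup>2"
  unfolding hgrad_add[OF assms] power2_norm_eq_inner
  by (simp add: inner_hgrad[symmetric] inner_add inner_commute)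

lemma transpose_hgrad_mult_eq_0_iff:
  "transpose (hgrad X u x) *v \<eta> = 0 \<longleftrightarrow> (\<forall>i. hderiv (X i) u x \<bullet> \<eta> = 0)"
  by (simp add: vec_eq_iff matrix_vector_mult_def transpose_def hgrad_def inner_vec_def)

lemma hgrad_mult_vec: "hgrad X u x *v c = (\<Sum>i\<in>UNIV. c $ i *\<^sub>R hderiv (X i) u x)"
  by (simp add: vec_eq_iff matrix_vector_mult_def hgrad_def mult.commute)

lemma borel_measurable_norm_hgrad:
  assumes "open D" "v \<in> Gamma1 X D"
  shows "(\<lambda>x. ereal (norm (hgrad X v x))) \<in> borel_measurable (lebesgue_on D)"
  using assms
  by (intro borel_measurable_ereal continuous_imp_measurable_on_sets_lebesgue
      continuous_on_norm continuous_on_hgrad) auto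

lemma E_inf_le:
  assumes "open D" "v \<in> Gamma1 X D" "\<And>x. x \<in> D \<Longrightarrow> norm (hgrad X v x) \<le> C"
  shows "E_inf X v D \<le> ereal C"
  unfolding E_inf_def
  by (rule esssup_I[OF borel_measurable_norm_hgrad[OF assms(1,2)]]) (auto simp: assms(3))

text \<open>
The set where a continuous function exceeds its essential supremum is open and null, hence empty.
So for \<open>\<Gamma>\<^sup>1\<close> maps the essential supremum may be treated as a supremum.
\<close>

lemma norm_hgrad_le_E_inf:
  assumes "open D" "v \<in> Gamma1 X D" "x \<in> D"
  shows "ereal (norm (hgrad X v x)) \<le> E_inf X v D"
proof (rule ccontr)
  assume "\<not> ?thesis"
  then have less: "E_inf X v D < ereal (norm (hgrad X v x))" by simp
  define U where "U = {y \<in> D. E_inf X v D < ereal (norm (hgrad X v y))}"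
  have "continuous_on D (\<lambda>y. ereal (norm (hgrad X v y)))"
    by (intro continuous_on_ereal continuous_on_norm continuous_on_hgrad assms)
  then have "open (D \<inter> (\<lambda>y. ereal (norm (hgrad X v y))) -` {E_inf X v D<..})"
    using assms(1) by (rule continuous_open_preimage) simp
  also have "D \<inter> (\<lambda>y. ereal (norm (hgrad X v y))) -` {E_inf X v D<..} = U"
    by (auto simp: U_def)
  finally have "open U" .
  moreover have "x \<in> U"
    using less assms by (simp add: U_def)
  ultimately have nonneg: "\<not> negligible U"
    using open_not_negligible by blast
  have "AE y in lebesgue_on D. ereal (norm (hgrad X v y)) \<le> E_inf X v D"
    unfolding E_inf_def by (rule esssup_AE)
  then have "AE y in lebesgue. y \<in> D \<longrightarrow> ereal (norm (hgrad X v y)) \<le> E_inf X v D"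
    using assms(1) by (subst (asm) AE_restrict_space_iff) auto
  then obtain N where "negligible N"
    "{y. \<not> (y \<in> D \<longrightarrow> ereal (norm (hgrad X v y)) \<le> E_inf X v D)} \<subseteq> N"
    by (auto simp: eventually_ae_filter_negligible)
  moreover from this have "U \<subseteq> N"
    by (auto simp: U_def not_le)
  ultimately have "negligible U"
    using negligible_subset by blast
  with nonneg show False by blast
qed

section \<open>The projection onto the normal space\<close>

lemma orth_proj_unique:
  fixes S :: "'a::real_inner set"
  assumes "subspace S" "z \<in> S" "\<And>w. w \<in> S \<Longrightarrow> orthogonal (y - z) w"
  shows "orth_proj S y = z"
  unfolding orth_proj_def
proof (rule the_equality)
  show "z \<in> S \<and> (\<forall>w\<in>S. orthogonal (y - z) w)"
    using assms by blast
  fix z' assume z': "z' \<in> S \<and> (\<forall>w\<in>S. orthogonal (y - z') w)"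
  then have "z - z' \<in> S"
    using assms subspace_diff by blast
  then have "(y - z') \<bullet> (z - z') = 0" "(y - z) \<bullet> (z - z') = 0"
    using assms z' by (auto simp: orthogonal_def)
  then have "(z - z') \<bullet> (z - z') = 0"
    by (simp add: inner_diff_left)
  then show "z' = z" by simp
qed

lemma orth_proj_works:
  fixes S :: "'a::euclidean_space set"
  assumes "subspace S"
  shows "orth_proj S y \<in> S" "w \<in> S \<Longrightarrow> orthogonal (y - orth_proj S y) w"
proof -
  obtain z z' where "z \<in> span S" "\<And>w. w \<in> span S \<Longrightarrow> orthogonal z' w" "y = z + z'"
    using orthogonal_subspace_decomp_exists[of S y] by metis
  moreover from this have "orth_proj S y = z"
    using assms by (intro orth_proj_unique) (auto simp: span_eq_iff[THEN iffD2])
  ultimately show "orth_proj S y \<in> S" "w \<in> S \<Longrightarrow> orthogonal (y - orth_proj S y) w"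
    using assms by (auto simp: span_eq_iff[THEN iffD2])
qed

lemma linear_orth_proj:
  fixes S :: "'a::euclidean_space set"
  assumes "subspace S"
  shows "linear (orth_proj S)"
proof (rule linearI)
  note P = orth_proj_works[OF assms]
  fix x y :: 'a and c :: real
  have "orthogonal (x + y - (orth_proj S x + orth_proj S y)) w" if "w \<in> S" for w
    using P(2)[of w x] P(2)[of w y] that by (simp add: orthogonal_def inner_diff_left inner_add_left)
  then show "orth_proj S (x + y) = orth_proj S x + orth_proj S y"
    by (intro orth_proj_unique assms subspace_add P)
  have "orthogonal (c *\<^sub>R x - c *\<^sub>R orth_proj S x) w" if "w \<in> S" for w
    using P(2)[of w x] that by (simp add: orthogonal_def inner_diff_left)
  then show "orth_proj S (c *\<^sub>R x) = c *\<^sub>R orth_proj S x"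
    by (intro orth_proj_unique assms subspace_scale P)
qed

text \<open>
The matrix \<open>[Xu]\<^sup>\<bottom>\<close> enters the proof only through these three properties of the orthogonal
projection onto the normal space \<open>{\<zeta>. \<forall>i. X\<^sub>iu \<bullet> \<zeta> = 0}\<close>.
\<close>

lemma perp_proj_works:
  shows "hderiv (X i) u x \<bullet> (perp_proj X u x *v \<eta>) = 0"
    and "(\<And>i. hderiv (X i) u x \<bullet> \<zeta> = 0) \<Longrightarrow> (perp_proj X u x *v \<eta>) \<bullet> \<zeta> = \<eta> \<bullet> \<zeta>"
    and "(\<And>i. hderiv (X i) u x \<bullet> \<zeta> = 0) \<Longrightarrow> perp_proj X u x *v \<zeta> = \<zeta>"
proof -
  define S where "S = {\<eta>. transpose (hgrad X u x) *v \<eta> = 0}"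
  have S: "subspace S"
    unfolding S_def transpose_hgrad_mult_eq_0_iff by (simp add: subspace_def inner_add_right)
  have S_iff: "\<zeta> \<in> S \<longleftrightarrow> (\<forall>i. hderiv (X i) u x \<bullet> \<zeta> = 0)" for \<zeta>
    unfolding S_def transpose_hgrad_mult_eq_0_iff by simp
  have P: "perp_proj X u x *v \<eta> = orth_proj S \<eta>" for \<eta>
    unfolding perp_proj_def S_def[symmetric]
    by (rule matrix_works) (simp add: linear_orth_proj[OF S] linear_matrix_vector_mul_eq)
  show "hderiv (X i) u x \<bullet> (perp_proj X u x *v \<eta>) = 0"
    using orth_proj_works(1)[OF S] by (simp add: P S_iff)
  show "(\<And>i. hderiv (X i) u x \<bullet> \<zeta> = 0) \<Longrightarrow> (perp_proj X u x *v \<eta>) \<bullet> \<zeta> = \<eta> \<bullet> \<zeta>"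
    using orth_proj_works(2)[OF S, of \<zeta> \<eta>] by (simp add: P S_iff orthogonal_def inner_diff_left)
  show "(\<And>i. hderiv (X i) u x \<bullet> \<zeta> = 0) \<Longrightarrow> perp_proj X u x *v \<zeta> = \<zeta>"
    unfolding P by (rule orth_proj_unique[OF S]) (auto simp: S_iff orthogonal_def)
qed

section \<open>The two parts of the system\<close>

definition hlaplacian ::
  "('m::finite \<Rightarrow> real^'n \<Rightarrow> real^'n) \<Rightarrow> (real^'n \<Rightarrow> real^'N) \<Rightarrow> real^'n \<Rightarrow> real^'N" where
  "hlaplacian X u x = (\<Sum>i\<in>UNIV. hderiv (X i) (hderiv (X i) u) x)"

text \<open>
This is \<open>X\<^sub>i(|Xu|\<^sup>2 / 2)\<close> with the derivative carried out.
\<close>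

definition henergy_deriv ::
  "('m::finite \<Rightarrow> real^'n \<Rightarrow> real^'n) \<Rightarrow> (real^'n \<Rightarrow> real^'N) \<Rightarrow> 'm \<Rightarrow> real^'n \<Rightarrow> real" where
  "henergy_deriv X u i x = (\<Sum>j\<in>UNIV. hderiv (X j) u x \<bullet> hderiv (X i) (hderiv (X j) u) x)"

text \<open>
In vector form the two terms of the system are visibly orthogonal: the first is a combination of
the vectors \<open>X\<^sub>iu\<close>, the second lies in the normal space.
\<close>

lemma solves_inf_laplace_iff:
  "solves_inf_laplace X \<Omega> u \<longleftrightarrow> (\<forall>x\<in>\<Omega>.
     (\<Sum>i\<in>UNIV. henergy_deriv X u i x *\<^sub>R hderiv (X i) u x)
     + (norm (hgrad X u x))\<^sup>2 *\<^sub>R (perp_proj X u x *v hlaplacian X u x) = 0)"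
proof -
  have 1: "(\<Sum>i\<in>UNIV. \<Sum>j\<in>UNIV. \<Sum>\<beta>\<in>UNIV.
        hgrad X u x $ \<alpha> $ i * hgrad X u x $ \<beta> $ j * hderiv (X i) (hderiv (X j) u) x $ \<beta>)
      = (\<Sum>i\<in>UNIV. henergy_deriv X u i x *\<^sub>R hderiv (X i) u x) $ \<alpha>" for x \<alpha>
    by (simp add: henergy_deriv_def hgrad_def inner_vec_def sum_distrib_left sum_distrib_right
        mult_ac)
  have 2: "(\<Sum>\<beta>\<in>UNIV. \<Sum>i\<in>UNIV. perp_proj X u x $ \<alpha> $ \<beta> * hderiv (X i) (hderiv (X i) u) x $ \<beta>)
      = (perp_proj X u x *v hlaplacian X u x) $ \<alpha>" for x \<alpha>
    by (simp add: hlaplacian_def matrix_vector_mult_def sum_distrib_left)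
  show ?thesis
    unfolding solves_inf_laplace_def 1 2 by (simp add: vec_eq_iff)
qed

lemma inj_hgrad_imp_eq_0:
  assumes "u \<in> h_immersions X \<Omega>" "x \<in> \<Omega>" "(\<Sum>i\<in>UNIV. c i *\<^sub>R hderiv (X i) u x) = 0"
  shows "c i = 0"
proof -
  have "inj ((*v) (hgrad X u x))"
    using assms by (simp add: h_immersions_def full_rank_injective[symmetric])
  moreover have "hgrad X u x *v (\<chi> i. c i) = hgrad X u x *v 0"
    using assms(3) by (simp add: hgrad_mult_vec)
  ultimately have "(\<chi> i. c i) = 0"
    by (rule injD)
  then show ?thesis
    by (simp add: vec_eq_iff)
qed

section \<open>Rank-one minimality and the tangential part\<close>

text \<open>
To first order in \<open>\<epsilon>\<close>, the supremum over the ball of radius \<open>\<epsilon>\<close> of a function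
differentiable at the centre is its central value plus \<open>\<epsilon>\<close> times the norm of its gradient.
Suprema over all small balls are therefore ordered only if the gradients are.
\<close>

lemma gradient_norm_le_if_sup_le:
  fixes \<phi> \<psi> :: "'a::real_inner \<Rightarrow> real"
  assumes \<psi>: "(\<psi> has_derivative (\<lambda>h. h \<bullet> q)) (at x)"
    and \<phi>: "(\<phi> has_derivative (\<lambda>h. h \<bullet> p)) (at x)"
    and eq: "\<phi> x = \<psi> x" and "0 < \<epsilon>0"
    and sup: "\<And>\<epsilon> C y. \<lbrakk>0 < \<epsilon>; \<epsilon> < \<epsilon>0; \<And>z. z \<in> ball x \<epsilon> \<Longrightarrow> \<phi> z \<le> C; y \<in> ball x \<epsilon>\<rbrakk> \<Longrightarrow> \<psi> y \<le> C"
  shows "norm q \<le> norm p"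
proof (rule ccontr)
  assume contr: "\<not> norm q \<le> norm p"
  define \<eta> where "\<eta> = (norm q - norm p) / 4"
  have "0 < \<eta>" and q: "norm q = norm p + 4 * \<eta>"
    using contr by (auto simp: \<eta>_def field_simps)
  obtain d1 where d1: "0 < d1"
    "\<And>y. norm (y - x) < d1 \<Longrightarrow> norm (\<psi> y - \<psi> x - (y - x) \<bullet> q) \<le> \<eta> * norm (y - x)"
    using \<psi> \<open>0 < \<eta>\<close> unfolding has_derivative_at_alt by blast
  obtain d2 where d2: "0 < d2"
    "\<And>y. norm (y - x) < d2 \<Longrightarrow> norm (\<phi> y - \<phi> x - (y - x) \<bullet> p) \<le> \<eta> * norm (y - x)"
    using \<phi> \<open>0 < \<eta>\<close> unfolding has_derivative_at_alt by blast
  define \<epsilon> where "\<epsilon> = min \<epsilon>0 (min d1 d2) / 2"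
  have \<epsilon>: "0 < \<epsilon>" "\<epsilon> < \<epsilon>0" "\<epsilon> < d1" "\<epsilon> < d2"
    using d1 d2 \<open>0 < \<epsilon>0\<close> by (auto simp: \<epsilon>_def)
  have upper: "\<phi> z \<le> \<phi> x + (norm p + \<eta>) * \<epsilon>" if "z \<in> ball x \<epsilon>" for z
  proof -
    have z: "norm (z - x) < \<epsilon>"
      using that by (simp add: dist_norm norm_minus_commute)
    have "\<phi> z \<le> \<phi> x + (z - x) \<bullet> p + \<eta> * norm (z - x)"
      using d2(2)[of z] z \<epsilon> by (simp add: abs_le_iff)
    also have "(z - x) \<bullet> p \<le> norm (z - x) * norm p"
      by (rule norm_cauchy_schwarz)
    also have "norm (z - x) * norm p \<le> \<epsilon> * norm p"
      using z by (intro mult_right_mono) auto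
    also have "\<eta> * norm (z - x) \<le> \<eta> * \<epsilon>"
      using z \<open>0 < \<eta>\<close> by (intro mult_left_mono) auto
    finally show ?thesis
      by (simp add: algebra_simps)
  qed
  \<comment> \<open>The ball is open, so the direction of steepest ascent of \<psi> is followed only up to the
    fraction s of the radius.\<close>
  define s where "s = (norm p + 2 * \<eta>) / (norm p + 3 * \<eta>)"
  have pos: "0 < norm p + 3 * \<eta>"
    using \<open>0 < \<eta>\<close> by (simp add: add_nonneg_pos)
  have s: "0 < s" "s < 1" "s * (norm p + 3 * \<eta>) = norm p + 2 * \<eta>"
    using pos less_imp_neq[OF pos] \<open>0 < \<eta>\<close> by (simp_all add: s_def add_nonneg_pos)
  have "0 < norm q"
    using q \<open>0 < \<eta>\<close> by (simp add: add_nonneg_pos)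
  define y where "y = x + (s * \<epsilon> / norm q) *\<^sub>R q"
  have y: "norm (y - x) = s * \<epsilon>" "(y - x) \<bullet> q = s * \<epsilon> * norm q"
    using s \<epsilon> \<open>0 < norm q\<close> by (auto simp: y_def dot_square_norm power2_eq_square)
  have s\<epsilon>: "s * \<epsilon> < \<epsilon>"
    using s \<epsilon> by simp
  then have "y \<in> ball x \<epsilon>"
    using y by (simp add: dist_norm norm_minus_commute)
  from sup[OF \<epsilon>(1,2) upper this] have "\<psi> y \<le> \<phi> x + (norm p + \<eta>) * \<epsilon>"
    by blast
  moreover have "\<psi> x + s * \<epsilon> * norm q - \<eta> * (s * \<epsilon>) \<le> \<psi> y"
    using d1(2)[of y] s\<epsilon> \<epsilon> y by (simp add: abs_le_iff)
  moreover have "s * \<epsilon> * norm q - \<eta> * (s * \<epsilon>) = s * (norm p + 3 * \<eta>) * \<epsilon>"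
    by (simp add: q algebra_simps)
  ultimately have "(norm p + 2 * \<eta>) * \<epsilon> \<le> (norm p + \<eta>) * \<epsilon>"
    using eq s(3) by simp
  then show False
    using \<epsilon>(1) \<open>0 < \<eta>\<close> by (simp add: mult_le_cancel_right)
qed

lemma inner_eq_0_if_norm_minimal:
  fixes q b :: "'a::real_inner"
  assumes "\<And>\<delta>::real. norm q \<le> norm (q - \<delta> *\<^sub>R b)"
  shows "b \<bullet> q = 0"
proof (cases "b = 0")
  case False
  define \<delta> where "\<delta> = (b \<bullet> q) / (b \<bullet> b)"
  have "(norm q)\<^sup>2 \<le> (norm (q - \<delta> *\<^sub>R b))\<^sup>2"
    using assms by (intro power_mono) auto
  also have "\<dots> = (norm q)\<^sup>2 - 2 * \<delta> * (b \<bullet> q) + \<delta> * (\<delta> * (b \<bullet> b))"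
    by (simp add: power2_norm_eq_inner inner_diff inner_commute algebra_simps)
  also have "\<delta> * (b \<bullet> b) = b \<bullet> q"
    using False by (simp add: \<delta>_def)
  finally have "\<delta> * (b \<bullet> q) \<le> 0"
    by simp
  then have "(b \<bullet> q)\<^sup>2 / (b \<bullet> b) \<le> 0"
    by (simp add: \<delta>_def power2_eq_square)
  moreover have "0 < b \<bullet> b"
    using False by simp
  ultimately show ?thesis
    by (simp add: divide_le_0_iff not_le del: inner_gt_zero_iff)
qed simp

text \<open>
The competitor is \<open>u + g\<xi>\<close> on a small ball around \<open>x\<close>, where \<open>g\<close> is a multiple of the
paraboloid vanishing on the sphere. Since \<open>Xg\<close> vanishes at the centre, \<open>|X(u + g\<xi>)|\<^sup>2\<close> and
\<open>|Xu|\<^sup>2\<close> agree there, and their gradients \<open>q - 2\<delta>b\<close> and \<open>q\<close> differ by a multiple of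
\<open>b = (X\<^sub>iu \<bullet> \<xi>) X\<^sub>i\<close>. Minimality gives \<open>|q| \<le> |q - 2\<delta>b|\<close> for every \<open>\<delta>\<close>, that is,
\<open>q\<close> is orthogonal to \<open>b\<close>, and this orthogonality is the claim.
\<close>

lemma rank_one_minimal_imp_tangential:
  fixes u :: "real^'n \<Rightarrow> real^'N"
  assumes "open \<Omega>" and X: "\<And>i. C1_on \<Omega> (X i)" and u: "u \<in> Gamma2 X \<Omega>"
    and min: "h_rank_one_absolute_minimal X \<Omega> u" and x: "x \<in> \<Omega>" and \<xi>: "norm \<xi> = 1"
  shows "(\<Sum>i\<in>UNIV. henergy_deriv X u i x * (hderiv (X i) u x \<bullet> \<xi>)) = 0"
proof -
  define U where "U = (\<lambda>j. hderiv (X j) u)"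
  define DU where "DU = (\<lambda>j. frechet_derivative (U j) (at x))"
  have u1: "u \<in> Gamma1 X \<Omega>"
    using u by (simp add: Gamma2_def)
  have DU: "(U j has_derivative DU j) (at x)" for j
    using u x unfolding DU_def U_def Gamma2_def by (blast intro: C1_on_has_derivative)
  have hU: "hderiv (X i) (hderiv (X j) u) x = DU j (X i x)" for i j
    using hderiv_has_derivative(2)[OF DU] by (simp add: U_def)
  have linDU: "linear (DU j)" for j
    using DU by (rule has_derivative_linear)
  have DX: "(X i has_derivative frechet_derivative (X i) (at x)) (at x)" for i
    using X x by (rule C1_on_has_derivative)
  define \<psi> where "\<psi> = (\<lambda>y. \<Sum>j\<in>UNIV. U j y \<bullet> U j y)"
  define \<psi>' where "\<psi>' = (\<lambda>h. 2 * (\<Sum>j\<in>UNIV. U j x \<bullet> DU j h))"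
  have \<psi>: "(\<psi> has_derivative \<psi>') (at x)"
    unfolding \<psi>_def \<psi>'_def
    by (auto intro!: derivative_eq_intros DU simp: sum_distrib_left inner_commute)
  have lin: "linear \<psi>'"
    using \<psi> by (rule has_derivative_linear)
  define q where "q = adjoint \<psi>' 1"
  have q: "\<psi>' h = h \<bullet> q" for h
    using adjoint_works[OF lin, of h 1] by (simp add: q_def)
  define b where "b = (\<Sum>i\<in>UNIV. (U i x \<bullet> \<xi>) *\<^sub>R X i x)"
  have "norm q \<le> norm (q - (2 * \<delta>) *\<^sub>R b)" for \<delta>
  proof -
    \<comment> \<open>The horizontal derivatives of the paraboloid \<open>\<delta> / 2 * (\<epsilon>\<^sup>2 - |y - x|\<^sup>2)\<close>, which do not
      depend on \<open>\<epsilon>\<close>.\<close>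
    define \<gamma> where "\<gamma> = (\<lambda>i y. - \<delta> * ((y - x) \<bullet> X i y))"
    have \<gamma>: "(\<gamma> i has_derivative (\<lambda>h. - \<delta> * (h \<bullet> X i x))) (at x)" for i
      unfolding \<gamma>_def by (auto intro!: derivative_eq_intros DX)
    define \<phi> where "\<phi> = (\<lambda>y. \<psi> y + 2 * (\<Sum>i\<in>UNIV. \<gamma> i y * (U i y \<bullet> \<xi>)) + (\<Sum>i\<in>UNIV. (\<gamma> i y)\<^sup>2))"
    have \<gamma>x: "\<gamma> i x = 0" for i
      by (simp add: \<gamma>_def)
    have "(\<phi> has_derivative (\<lambda>h. \<psi>' h + 2 * (\<Sum>i\<in>UNIV. (- \<delta> * (h \<bullet> X i x)) * (U i x \<bullet> \<xi>)))) (at x)"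
      unfolding \<phi>_def by (auto intro!: derivative_eq_intros \<psi> \<gamma> DU simp: \<gamma>x)
    moreover have "\<psi>' h + 2 * (\<Sum>i\<in>UNIV. (- \<delta> * (h \<bullet> X i x)) * (U i x \<bullet> \<xi>))
        = h \<bullet> (q - (2 * \<delta>) *\<^sub>R b)" for h
      by (simp add: q b_def inner_diff_right inner_sum_right sum_distrib_left sum_negf mult_ac)
    ultimately have \<phi>: "(\<phi> has_derivative (\<lambda>h. h \<bullet> (q - (2 * \<delta>) *\<^sub>R b))) (at x)"
      by simp
    obtain \<epsilon>0 where \<epsilon>0: "0 < \<epsilon>0" "cball x \<epsilon>0 \<subseteq> \<Omega>"
      using \<open>open \<Omega>\<close> x open_contains_cball by blast
    show ?thesis
    proof (rule gradient_norm_le_if_sup_le[OF \<psi>[unfolded q[abs_def]] \<phi> _ \<epsilon>0(1)])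
      show "\<phi> x = \<psi> x"
        by (simp add: \<phi>_def \<gamma>x)
      fix \<epsilon> C y
      assume \<epsilon>: "0 < \<epsilon>" "\<epsilon> < \<epsilon>0" and C: "\<And>z. z \<in> ball x \<epsilon> \<Longrightarrow> \<phi> z \<le> C" and y: "y \<in> ball x \<epsilon>"
      define D where "D = ball x \<epsilon>"
      have D: "compact_subdomain D \<Omega>"
        using \<epsilon> \<epsilon>0 by (auto simp: D_def compact_subdomain_def)
      have D\<Omega>: "D \<subseteq> \<Omega>" "open D"
        using \<epsilon> \<epsilon>0 by (auto simp: D_def)
      define g where "g = (\<lambda>y. \<delta> / 2 * (\<epsilon>\<^sup>2 - (y - x) \<bullet> (y - x)))"
      have "(g has_derivative (\<lambda>h. - \<delta> * ((y - x) \<bullet> h))) (at y)" for y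
        unfolding g_def by (auto intro!: derivative_eq_intros simp: inner_commute)
      note g = hderiv_has_derivative[OF this]
      have g': "hderiv (X i) g = \<gamma> i" for i
        by (simp add: fun_eq_iff g(2) \<gamma>_def)
      have Xcont: "continuous_on D (X i)" for i
        using X D\<Omega> by (blast intro: continuous_on_subset C1_on_imp_continuous_on)
      have "g \<in> Gamma1_0 X D"
        unfolding Gamma1_0_def
      proof (intro CollectI conjI allI ballI)
        show "continuous_on (closure D) g"
          unfolding g_def by (intro continuous_intros)
        show "continuous_on D (hderiv (X i) g)" for i
          unfolding g' \<gamma>_def by (intro continuous_intros Xcont)
        show "hderivable (X i) g x" for i x
          by (rule g(1))
        show "g z = 0" if "z \<in> frontier D" for z
          using that \<epsilon> by (auto simp: g_def D_def dot_square_norm dist_norm norm_minus_commute)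
      qed
      define w where "w = (\<lambda>y. g y *\<^sub>R \<xi>)"
      have w: "w \<in> Gamma1 X D"
        unfolding w_def
        by (intro Gamma1_scaleR Gamma1_const Gamma1_0_imp_Gamma1 \<open>g \<in> Gamma1_0 X D\<close>)
      have w': "hderiv (X i) w z = \<gamma> i z *\<^sub>R \<xi>" for i z
      proof -
        note const = hderiv_has_derivative[OF has_derivative_const]
        show ?thesis
          unfolding w_def
          by (subst hderiv_bilinear(2)[OF bounded_bilinear_scaleR g(1) const(1)])
            (simp add: const(2) g')
      qed
      have uD: "u \<in> Gamma1 X D"
        using u1 D\<Omega>(1) by (rule Gamma1_mono)
      have uw: "(\<lambda>x. u x + w x) \<in> Gamma1 X D"
        using uD w by (rule Gamma1_add)
      have norm_u: "(norm (hgrad X u z))\<^sup>2 = \<psi> z" for z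
        by (simp add: norm_hgrad_eq \<psi>_def U_def)
      have norm_uw: "(norm (hgrad X (\<lambda>x. u x + w x) z))\<^sup>2 = \<phi> z" if "z \<in> D" for z
        unfolding norm_hgrad_add[OF uD w that] norm_u norm_hgrad_eq[of X w]
        using \<xi> by (simp add: \<phi>_def w' U_def dot_square_norm power2_eq_square)
      have C0: "0 \<le> C"
      proof -
        have "x \<in> D"
          using \<epsilon> by (simp add: D_def)
        then have "\<phi> x = (norm (hgrad X (\<lambda>x. u x + w x) x))\<^sup>2" "\<phi> x \<le> C"
          using norm_uw C by (auto simp: D_def)
        then show ?thesis
          using zero_le_power2[of "norm (hgrad X (\<lambda>x. u x + w x) x)"] by linarith
      qed
      have "ereal (norm (hgrad X u y)) \<le> E_inf X u D"
        using y D\<Omega> uD by (intro norm_hgrad_le_E_inf) (auto simp: D_def)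
      also have "\<dots> \<le> E_inf X (\<lambda>x. u x + w x) D"
        using min D \<open>g \<in> Gamma1_0 X D\<close> \<xi> unfolding h_rank_one_absolute_minimal_def w_def by blast
      also have "\<dots> \<le> ereal (sqrt C)"
      proof (rule E_inf_le[OF D\<Omega>(2) uw])
        fix z assume "z \<in> D"
        then show "norm (hgrad X (\<lambda>x. u x + w x) z) \<le> sqrt C"
          using C[of z] norm_uw[of z] by (intro real_le_rsqrt) (simp add: D_def)
      qed
      finally have "(norm (hgrad X u y))\<^sup>2 \<le> (sqrt C)\<^sup>2"
        by (intro power_mono) auto
      then show "\<psi> y \<le> C"
        using C0 norm_u by simp
    qed
  qed
  from this[of "\<delta> / 2" for \<delta>] have "b \<bullet> q = 0"
    by (intro inner_eq_0_if_norm_minimal) simp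
  then have "0 = \<psi>' b"
    by (simp add: q)
  also have "\<dots> = 2 * (\<Sum>j\<in>UNIV. \<Sum>i\<in>UNIV. (U i x \<bullet> \<xi>) * (U j x \<bullet> DU j (X i x)))"
    by (simp add: \<psi>'_def b_def linear_sum[OF linDU] linear_cmul[OF linDU] inner_sum_right)
  also have "\<dots> = 2 * (\<Sum>i\<in>UNIV. henergy_deriv X u i x * (hderiv (X i) u x \<bullet> \<xi>))"
    unfolding henergy_deriv_def sum_distrib_right
    by (subst sum.swap) (simp add: hU, simp add: U_def mult_ac)
  finally show ?thesis by simp
qed

section \<open>Minimal area and the normal part\<close>

lemma C1_on_inner:
  fixes f g :: "'a::real_normed_vector \<Rightarrow> real^'k"
  shows "C1_on S f \<Longrightarrow> C1_on S g \<Longrightarrow> C1_on S (\<lambda>x. f x \<bullet> g x)"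
  unfolding inner_vec_def inner_real_def by (intro C1_on_sum C1_on_mult C1_on_vec_nth)

text \<open>
Subtract from the constant vector \<open>\<eta>\<close> its projection onto the span of the \<open>U\<^sub>i(y)\<close>. The
coefficients of the projection solve a linear system whose Gram matrix \<open>A(y)\<close> is invertible by
independence; Cramer's rule shows that they depend on \<open>y\<close> in a \<open>C\<^sup>1\<close> way.
\<close>

lemma vertical_extension_exists:
  fixes U :: "'m::finite \<Rightarrow> 'a::real_normed_vector \<Rightarrow> real^'N"
  assumes U: "\<And>i. C1_on \<Omega> (U i)"
    and indep: "\<And>y c i. y \<in> \<Omega> \<Longrightarrow> (\<Sum>i\<in>UNIV. c i *\<^sub>R U i y) = 0 \<Longrightarrow> c i = 0"
    and x: "x \<in> \<Omega>" "\<And>i. U i x \<bullet> \<eta> = 0"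
  obtains \<nu> where "C1_on \<Omega> \<nu>" "\<nu> x = \<eta>" "\<And>y i. y \<in> \<Omega> \<Longrightarrow> U i y \<bullet> \<nu> y = 0"
proof -
  define A :: "'a \<Rightarrow> real^'m^'m" where "A = (\<lambda>y. \<chi> i j. U i y \<bullet> U j y)"
  define b :: "'a \<Rightarrow> real^'m" where "b = (\<lambda>y. \<chi> i. U i y \<bullet> \<eta>)"
  define c :: "'a \<Rightarrow> real^'m" where
    "c = (\<lambda>y. \<chi> k. det (\<chi> i j. if j = k then b y $ i else A y $ i $ j) / det (A y))"
  define \<nu> where "\<nu> = (\<lambda>y. \<eta> + (\<Sum>k\<in>UNIV. (- c y $ k) *\<^sub>R U k y))"
  have det: "det (A y) \<noteq> 0" if y: "y \<in> \<Omega>" for y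
  proof -
    have "v = 0" if "A y *v v = 0" for v
    proof -
      define z where "z = (\<Sum>i\<in>UNIV. v $ i *\<^sub>R U i y)"
      have "z \<bullet> z = (\<Sum>i\<in>UNIV. v $ i * (U i y \<bullet> z))"
        by (subst (1) z_def) (simp add: inner_sum_left)
      also have "\<dots> = v \<bullet> (A y *v v)"
        by (simp add: z_def A_def inner_sum_right inner_vec_def[of v]
            matrix_vector_mult_def mult_ac)
      finally have "z \<bullet> z = 0"
        using that by simp
      then have "(\<Sum>i\<in>UNIV. v $ i *\<^sub>R U i y) = 0"
        by (simp add: z_def[symmetric])
      from indep[OF y this] show "v = 0"
        by (simp add: vec_eq_iff)
    qed
    then show ?thesis
      by (metis invertible_det_nz invertible_left_inverse matrix_left_invertible_ker)
  qed
  have Ac: "A y *v c y = b y" if "y \<in> \<Omega>" for y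
    using cramer[OF det[OF that], of "c y" "b y"] by (simp add: c_def)
  have A1: "C1_on \<Omega> (\<lambda>y. A y $ i $ j)" and b1: "C1_on \<Omega> (\<lambda>y. b y $ i)" for i j
    by (simp_all add: A_def b_def C1_on_inner U C1_on_const)
  have entry: "C1_on \<Omega> (\<lambda>y. (\<chi> i j. if j = k then b y $ i else A y $ i $ j) $ i $ j)" for k i j
    by (cases "j = k") (simp_all add: A1 b1)
  have "C1_on \<Omega> (\<lambda>y. c y $ k)" for k
    unfolding c_def by (simp add: divide_inverse, intro C1_on_mult C1_on_inverse C1_on_det A1 det entry)
  then have "C1_on \<Omega> (\<lambda>y. (- c y $ k) * U k y $ l)" for k l
    using C1_on_mult[OF C1_on_mult[OF C1_on_const[where c = "-1"]] C1_on_vec_nth[OF U]] by force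
  then have \<nu>1: "C1_on \<Omega> \<nu>"
    by (intro C1_on_vec_lambda) (simp add: \<nu>_def, intro C1_on_add C1_on_const C1_on_sum)
  have "c x = 0"
  proof -
    have "b x = 0"
      using x by (simp add: b_def vec_eq_iff)
    then show ?thesis
      using cramer[OF det[OF x(1)], of 0 "b x"] by (simp add: c_def)
  qed
  then have "\<nu> x = \<eta>"
    by (simp add: \<nu>_def)
  moreover have "U i y \<bullet> \<nu> y = 0" if "y \<in> \<Omega>" for y i
  proof -
    have "(A y *v c y) $ i = b y $ i"
      using Ac[OF that] by simp
    then show ?thesis
      by (simp add: \<nu>_def A_def b_def inner_add_right inner_diff_right inner_sum_right matrix_vector_mult_def
          sum_negf mult_ac)
  qed
  ultimately show ?thesis
    using that \<nu>1 by blast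
qed

text \<open>
Differentiate \<open>X\<^sub>iu \<bullet> \<nu> = 0\<close> along \<open>X\<^sub>i\<close> and sum over \<open>i\<close>.
\<close>

lemma vertical_field_divergence:
  fixes u :: "real^'n \<Rightarrow> real^'N"
  assumes "open D" "D \<subseteq> \<Omega>" "u \<in> Gamma2 X \<Omega>" "\<nu> \<in> Gamma1 X D"
    and vert: "\<And>y i. y \<in> D \<Longrightarrow> hderiv (X i) u y \<bullet> \<nu> y = 0" and "x \<in> D"
  shows "(\<Sum>i\<in>UNIV. hderiv (X i) u x \<bullet> hderiv (X i) \<nu> x) = - (\<nu> x \<bullet> hlaplacian X u x)"
proof -
  have "hderiv (X i) u x \<bullet> hderiv (X i) \<nu> x = - (hderiv (X i) (hderiv (X i) u) x \<bullet> \<nu> x)" for i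
  proof -
    have "(hderiv (X i) u has_derivative frechet_derivative (hderiv (X i) u) (at x)) (at x)"
      using assms by (intro C1_on_has_derivative[of \<Omega>]) (auto simp: Gamma2_def)
    then have "hderivable (X i) (hderiv (X i) u) x"
      by (rule hderiv_has_derivative)
    moreover have "hderivable (X i) \<nu> x"
      using assms by (simp add: Gamma1_def)
    ultimately have "hderiv (X i) (\<lambda>y. hderiv (X i) u y \<bullet> \<nu> y) x
        = hderiv (X i) u x \<bullet> hderiv (X i) \<nu> x + hderiv (X i) (hderiv (X i) u) x \<bullet> \<nu> x"
      by (rule hderiv_bilinear[OF bounded_bilinear_inner])
    moreover have "hderiv (X i) (\<lambda>y. hderiv (X i) u y \<bullet> \<nu> y) x = 0"
      using assms(1,6) vert by (rule hderiv_locally_constant)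
    ultimately show ?thesis by simp
  qed
  then show ?thesis
    by (simp add: hlaplacian_def inner_sum_right sum_negf inner_commute)
qed

text \<open>
The previous lemma applies to the vertical field \<open>h\<nu>\<close>, so the term that is linear in the
variation contains no derivative of \<open>h\<close> or of \<open>\<nu>\<close>.
\<close>

lemma vertical_variation_energy:
  fixes u :: "real^'n \<Rightarrow> real^'N"
  assumes D: "open D" "D \<subseteq> \<Omega>" and u: "u \<in> Gamma2 X \<Omega>" and h: "h \<in> Gamma1 X D"
    and \<nu>: "\<nu> \<in> Gamma1 X D" "\<And>y i. y \<in> D \<Longrightarrow> hderiv (X i) u y \<bullet> \<nu> y = 0" and x: "x \<in> D"
  shows "(norm (hgrad X (\<lambda>x. u x + h x *\<^sub>R \<nu> x) x))\<^sup>2 = (norm (hgrad X u x))\<^sup>2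
    - 2 * h x * (\<nu> x \<bullet> hlaplacian X u x) + (norm (hgrad X (\<lambda>x. h x *\<^sub>R \<nu> x) x))\<^sup>2"
proof -
  have uD: "u \<in> Gamma1 X D"
    using u D(2) by (auto simp: Gamma2_def intro: Gamma1_mono)
  have h\<nu>: "(\<lambda>x. h x *\<^sub>R \<nu> x) \<in> Gamma1 X D"
    using h \<nu>(1) by (rule Gamma1_scaleR)
  have "(\<Sum>i\<in>UNIV. hderiv (X i) u x \<bullet> hderiv (X i) (\<lambda>x. h x *\<^sub>R \<nu> x) x)
      = - (h x * (\<nu> x \<bullet> hlaplacian X u x))"
    using vertical_field_divergence[OF D u h\<nu> _ x] \<nu>(2) by simp
  then show ?thesis
    using norm_hgrad_add[OF uD h\<nu> x] by simp
qed

text \<open>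
If the inner product were positive, it would stay positive near \<open>x\<close> along a vertical extension
\<open>\<nu>\<close> of \<open>\<eta>\<close>. Adding \<open>\<delta>\<nu>\<close> with a small constant \<open>\<delta>\<close> would then lower
\<open>|Xu|\<^sup>2\<close> on a whole ball by a fixed amount, because the gain is linear and the loss quadratic
in \<open>\<delta>\<close>. The area condition does not prescribe boundary values, so a constant factor is admissible.
\<close>

lemma minimal_area_imp_normal_nonpos:
  fixes u :: "real^'n \<Rightarrow> real^'N"
  assumes "open \<Omega>" and X: "\<And>i. C1_on \<Omega> (X i)" and u: "u \<in> Gamma2 X \<Omega>" "u \<in> h_immersions X \<Omega>"
    and min: "h_inf_minimal_area X \<Omega> u" and x: "x \<in> \<Omega>" and \<eta>: "\<And>i. hderiv (X i) u x \<bullet> \<eta> = 0"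
  shows "\<eta> \<bullet> hlaplacian X u x \<le> 0"
proof (rule ccontr)
  assume contr: "\<not> \<eta> \<bullet> hlaplacian X u x \<le> 0"
  define s where "s = \<eta> \<bullet> hlaplacian X u x"
  have "0 < s"
    using contr by (simp add: s_def)
  have Xcont: "continuous_on \<Omega> (X i)" for i
    using X by (rule C1_on_imp_continuous_on)
  have U1: "C1_on \<Omega> (hderiv (X i) u)" for i
    using u by (simp add: Gamma2_def)
  obtain \<nu> where \<nu>: "C1_on \<Omega> \<nu>" "\<nu> x = \<eta>" "\<And>y i. y \<in> \<Omega> \<Longrightarrow> hderiv (X i) u y \<bullet> \<nu> y = 0"
    by (rule vertical_extension_exists[of \<Omega> "\<lambda>i. hderiv (X i) u" x \<eta>])
      (auto intro: U1 inj_hgrad_imp_eq_0[OF u(2)] simp: x \<eta>)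
  have \<nu>G: "\<nu> \<in> Gamma1 X \<Omega>"
    using \<nu>(1) Xcont by (rule C1_on_imp_Gamma1)
  have "continuous_on \<Omega> (hderiv (X i) (hderiv (X i) u))" for i
    using C1_on_imp_Gamma1[where X = X, OF U1 Xcont] by (simp add: Gamma1_def)
  then have "continuous_on \<Omega> (\<lambda>y. \<nu> y \<bullet> hlaplacian X u y)"
    unfolding hlaplacian_def by (intro continuous_intros C1_on_imp_continuous_on[OF \<nu>(1)])
  then have "open (\<Omega> \<inter> (\<lambda>y. \<nu> y \<bullet> hlaplacian X u y) -` {s / 2<..})"
    using \<open>open \<Omega>\<close> by (rule continuous_open_preimage) simp
  moreover have "x \<in> \<Omega> \<inter> (\<lambda>y. \<nu> y \<bullet> hlaplacian X u y) -` {s / 2<..}"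
    using x \<nu>(2) \<open>0 < s\<close> by (simp add: s_def)
  ultimately obtain \<epsilon> where \<epsilon>: "0 < \<epsilon>" "cball x \<epsilon> \<subseteq> \<Omega> \<inter> (\<lambda>y. \<nu> y \<bullet> hlaplacian X u y) -` {s / 2<..}"
    using open_contains_cball by blast
  define D where "D = ball x \<epsilon>"
  have D: "open D" "D \<subseteq> \<Omega>" "x \<in> D" "compact_subdomain D \<Omega>"
    using \<epsilon> by (auto simp: D_def compact_subdomain_def)
  have bounded: "\<exists>K>0. \<forall>y\<in>D. norm (hgrad X v y) \<le> K" if "v \<in> Gamma1 X \<Omega>" for v :: "real^'n \<Rightarrow> real^'N"
  proof -
    have "compact (hgrad X v ` cball x \<epsilon>)"
      using continuous_on_hgrad[OF that] \<epsilon>(2)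
      by (intro compact_continuous_image compact_cball) (auto intro: continuous_on_subset)
    then show ?thesis
      by (force simp: D_def dest!: compact_imp_bounded simp: bounded_pos)
  qed
  have u1: "u \<in> Gamma1 X \<Omega>"
    using u by (simp add: Gamma2_def)
  obtain K where K: "0 < K" "\<And>y. y \<in> D \<Longrightarrow> norm (hgrad X \<nu> y) \<le> K"
    using bounded[OF \<nu>G] by blast
  obtain L where L: "\<And>y. y \<in> D \<Longrightarrow> norm (hgrad X u y) \<le> L"
    using bounded[OF u1] by blast
  note uD = Gamma1_mono[OF u1 D(2)] and \<nu>D = Gamma1_mono[OF \<nu>G D(2)]
  \<comment> \<open>With this \<open>\<delta>\<close> the loss \<open>\<delta>\<^sup>2 K\<^sup>2\<close> is half of the lower bound \<open>\<delta> s\<close> for the gain.\<close>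
  define \<delta> where "\<delta> = s / (2 * K\<^sup>2)"
  define w where "w = (\<lambda>x. u x + \<delta> *\<^sub>R \<nu> x)"
  have wG: "w \<in> Gamma1 X D"
    unfolding w_def by (intro Gamma1_add Gamma1_scaleR Gamma1_const uD \<nu>D)
  have "0 < \<delta>"
    using \<open>0 < s\<close> K by (simp add: \<delta>_def)
  have w: "(norm (hgrad X w y))\<^sup>2 \<le> (norm (hgrad X u y))\<^sup>2 - \<delta> * s / 2" if y: "y \<in> D" for y
  proof -
    have "hgrad X (\<lambda>x. \<delta> *\<^sub>R \<nu> x) y = \<delta> *\<^sub>R hgrad X \<nu> y"
    proof -
      have "hderiv (X i) (\<lambda>x. \<delta> *\<^sub>R \<nu> x) y = \<delta> *\<^sub>R hderiv (X i) \<nu> y" for i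
        using hderiv_bilinear(2)[OF bounded_bilinear_scaleR
            hderiv_has_derivative(1)[OF has_derivative_const], of "X i" \<nu> y \<delta>] \<nu>D y
        by (simp add: Gamma1_def hderiv_has_derivative(2)[OF has_derivative_const])
      then show ?thesis
        by (simp add: hgrad_def vec_eq_iff)
    qed
    then have "(norm (hgrad X (\<lambda>x. \<delta> *\<^sub>R \<nu> x) y))\<^sup>2 \<le> \<delta>\<^sup>2 * K\<^sup>2"
      using K(2)[OF y] by (simp add: power_mult_distrib mult_left_mono power_mono)
    also have "\<dots> = \<delta> * s / 2"
      using K by (simp add: \<delta>_def power2_eq_square)
    finally have "(norm (hgrad X (\<lambda>x. \<delta> *\<^sub>R \<nu> x) y))\<^sup>2 \<le> \<delta> * s / 2" .
    moreover have "s / 2 \<le> \<nu> y \<bullet> hlaplacian X u y"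
      using y subsetD[OF \<epsilon>(2), of y] by (simp add: D_def)
    then have "\<delta> * (s / 2) \<le> \<delta> * (\<nu> y \<bullet> hlaplacian X u y)"
      using \<open>0 < \<delta>\<close> by (intro mult_left_mono) auto
    moreover have "(norm (hgrad X w y))\<^sup>2 = (norm (hgrad X u y))\<^sup>2
        - 2 * \<delta> * (\<nu> y \<bullet> hlaplacian X u y) + (norm (hgrad X (\<lambda>x. \<delta> *\<^sub>R \<nu> x) y))\<^sup>2"
      unfolding w_def using D \<nu>(3)
      by (intro vertical_variation_energy[OF D(1,2) u(1) Gamma1_const \<nu>D _ y]) blast
    ultimately show ?thesis
      by simp
  qed
  define \<theta> where "\<theta> = \<delta> * s / 2"
  have "0 < \<theta>"
    using \<open>0 < \<delta>\<close> \<open>0 < s\<close> by (simp add: \<theta>_def)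
  have "E_inf X u D \<le> ereal L"
    using L by (rule E_inf_le[OF D(1) uD])
  moreover have "ereal (norm (hgrad X u x)) \<le> E_inf X u D"
    by (rule norm_hgrad_le_E_inf[OF D(1) uD D(3)])
  ultimately obtain r where r: "E_inf X u D = ereal r"
    by (cases "E_inf X u D") auto
  have u_le: "norm (hgrad X u y) \<le> r" if "y \<in> D" for y
    using norm_hgrad_le_E_inf[OF D(1) uD that] r by simp
  have w_le: "norm (hgrad X w y) \<le> sqrt (r\<^sup>2 - \<theta>)" if "y \<in> D" for y
  proof (rule real_le_rsqrt)
    have "(norm (hgrad X u y))\<^sup>2 \<le> r\<^sup>2"
      using u_le[OF that] by (intro power_mono) auto
    then show "(norm (hgrad X w y))\<^sup>2 \<le> r\<^sup>2 - \<theta>"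
      using w[OF that] by (simp add: \<theta>_def)
  qed
  have "0 \<le> r"
    using u_le[OF D(3)] norm_ge_zero by (rule order_trans[rotated])
  have \<delta>G: "(\<lambda>x. \<delta>) \<in> Gamma1_closure X D"
  proof -
    note const = hderiv_has_derivative[OF has_derivative_const]
    have "hderiv (X i) (\<lambda>x. \<delta>) = (\<lambda>x. 0)" for i
      by (simp add: fun_eq_iff const(2))
    then show ?thesis
      unfolding Gamma1_closure_def
      by (auto simp: const(1) continuous_on_const intro!: exI[of _ "\<lambda>x. 0"])
  qed
  have \<nu>V: "\<nu> \<in> vertical_fields X u D"
  proof -
    have "\<nu> y = perp_proj X u y *v \<nu> y" if "y \<in> D" for y
      using perp_proj_works(3)[of X u y "\<nu> y"] \<nu>(3)[of y] D(2) that by auto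
    then show ?thesis
      unfolding vertical_fields_def using \<nu>D by blast
  qed
  have "E_inf X u D \<le> E_inf X w D"
    using min[unfolded h_inf_minimal_area_def, THEN conjunct2, rule_format, OF D(4) \<delta>G \<nu>V]
    by (simp add: w_def)
  also have "E_inf X w D \<le> ereal (sqrt (r\<^sup>2 - \<theta>))"
    using w_le by (rule E_inf_le[OF D(1) wG])
  finally have "r \<le> sqrt (r\<^sup>2 - \<theta>)"
    by (simp add: r)
  also have "\<dots> < sqrt (r\<^sup>2)"
    using \<open>0 < \<theta>\<close> by (intro real_sqrt_less_mono) simp
  finally show False
    using \<open>0 \<le> r\<close> by simp
qed

text \<open>
The tangential term of the system vanishes by testing with the coordinate vectors. The normal term
is the projection \<open>\<zeta>\<close> of the horizontal Laplacian: for a submersion the normal space is trivial,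
and for an immersion \<open>|\<zeta>|\<^sup>2\<close> is the inner product of \<open>\<zeta>\<close> with the Laplacian, which is not
positive.
\<close>

lemma minimal_map_imp_solves:
  fixes u :: "real^'n \<Rightarrow> real^'N"
  assumes "open \<Omega>" and X: "\<And>i. C1_on \<Omega> (X i)" and u: "u \<in> Gamma2_rk X \<Omega>"
    and min: "h_inf_minimal_map X \<Omega> u"
  shows "solves_inf_laplace X \<Omega> u"
  unfolding solves_inf_laplace_iff
proof
  fix x assume x: "x \<in> \<Omega>"
  have u2: "u \<in> Gamma2 X \<Omega>"
    using u by (auto simp: Gamma2_rk_def Gamma2_im_def Gamma2_sb_def)
  define T where "T = (\<Sum>i\<in>UNIV. henergy_deriv X u i x *\<^sub>R hderiv (X i) u x)"
  have "T $ \<alpha> = 0" for \<alpha>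
  proof -
    have "T \<bullet> axis \<alpha> 1 = 0"
      using rank_one_minimal_imp_tangential[OF assms(1) X u2 _ x, of "axis \<alpha> 1"] min
      by (simp add: T_def inner_sum_left h_inf_minimal_map_def)
    then show ?thesis
      by (simp add: inner_axis)
  qed
  then have "T = 0"
    by (simp add: vec_eq_iff)
  moreover define \<zeta> where "\<zeta> = perp_proj X u x *v hlaplacian X u x"
  have ker: "hderiv (X i) u x \<bullet> \<zeta> = 0" for i
    unfolding \<zeta>_def by (rule perp_proj_works)
  have "\<zeta> = 0"
  proof (cases "u \<in> h_immersions X \<Omega>")
    case True
    have "\<zeta> \<bullet> hlaplacian X u x \<le> 0"
      using minimal_area_imp_normal_nonpos[OF assms(1) X u2 True _ x ker] min
      by (simp add: h_inf_minimal_map_def)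
    moreover have "\<zeta> \<bullet> \<zeta> = hlaplacian X u x \<bullet> \<zeta>"
      unfolding \<zeta>_def by (rule perp_proj_works(2)) (rule perp_proj_works)
    ultimately have "\<zeta> \<bullet> \<zeta> \<le> 0"
      by (simp add: inner_commute)
    then show ?thesis
      by (metis antisym inner_eq_zero_iff inner_ge_zero)
  next
    case False
    then have "rank (hgrad X u x) = CARD('N)"
      using u x by (auto simp: Gamma2_rk_def Gamma2_im_def Gamma2_sb_def h_submersions_def)
    then have "inj ((*v) (transpose (hgrad X u x)))"
      by (simp add: full_rank_injective[symmetric] rank_transpose del: transpose_matrix_vector)
    moreover have "transpose (hgrad X u x) *v \<zeta> = transpose (hgrad X u x) *v 0"
      using ker transpose_hgrad_mult_eq_0_iff[of X u x \<zeta>] by (simp del: transpose_matrix_vector)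
    ultimately show ?thesis
      by (rule injD)
  qed
  ultimately show "(\<Sum>i\<in>UNIV. henergy_deriv X u i x *\<^sub>R hderiv (X i) u x)
     + (norm (hgrad X u x))\<^sup>2 *\<^sub>R (perp_proj X u x *v hlaplacian X u x) = 0"
    by (simp add: T_def \<zeta>_def)
qed

section \<open>Constancy along admissible curves\<close>

text \<open>
The families of intervals, given by their end points, that the definition of absolute continuity
quantifies over.
\<close>

definition disjoint_intervals :: "real \<Rightarrow> real \<Rightarrow> (real \<times> real) set \<Rightarrow> bool" where
  "disjoint_intervals a b I \<longleftrightarrow> finite I \<and> (\<forall>(s, t)\<in>I. a \<le> s \<and> s < t \<and> t \<le> b) \<and>
     pairwise (\<lambda>(s, t) (s', t'). disjnt {s<..<t} {s'<..<t'}) I"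

lemma absolutely_continuous_curve_iff:
  "absolutely_continuous_curve a b r \<longleftrightarrow> (\<forall>e>0. \<exists>d>0. \<forall>I.
     disjoint_intervals a b I \<and> (\<Sum>(s, t)\<in>I. t - s) < d \<longrightarrow> (\<Sum>(s, t)\<in>I. norm (r t - r s)) < e)"
  by (simp only: absolutely_continuous_curve_def disjoint_intervals_def conj_assoc)

lemma absolutely_continuous_curve_imp_continuous_on:
  assumes r: "absolutely_continuous_curve a b r"
  shows "continuous_on {a..b} r"
  unfolding continuous_on_iff
proof (intro ballI allI impI)
  fix t e :: real
  assume t: "t \<in> {a..b}" and "0 < e"
  obtain d where d: "0 < d" "\<And>I. disjoint_intervals a b I \<Longrightarrow> (\<Sum>(s, t)\<in>I. t - s) < d
     \<Longrightarrow> (\<Sum>(s, t)\<in>I. norm (r t - r s)) < e"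
    using r \<open>0 < e\<close> unfolding absolutely_continuous_curve_iff by blast
  have one: "norm (r v - r u) < e" if "a \<le> u" "u < v" "v \<le> b" "v - u < d" for u v
    using d(2)[of "{(u, v)}"] that by (simp add: disjoint_intervals_def)
  have "dist (r s) (r t) < e" if "s \<in> {a..b}" "dist s t < d" for s
    using one[of s t] one[of t s] that t \<open>0 < e\<close>
    by (cases s t rule: linorder_cases) (auto simp: dist_norm norm_minus_commute)
  then show "\<exists>d>0. \<forall>s\<in>{a..b}. dist s t < d \<longrightarrow> dist (r s) (r t) < e"
    using d(1) by blast
qed

text \<open>
Degenerate intervals of a tagged division contribute nothing, and by disjointness of interiors the
remaining ones have total length at most the measure of any set covering them. This transfers
absolute continuity to the divisions used for gauge integrals.
\<close>

lemma absolutely_continuous_curve_tagged_sum_less: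
  fixes r :: "real \<Rightarrow> 'a::real_normed_vector"
  assumes AC: "\<And>I. disjoint_intervals a b I \<Longrightarrow> (\<Sum>(s, t)\<in>I. t - s) < d
     \<Longrightarrow> (\<Sum>(s, t)\<in>I. norm (r t - r s)) < e"
    and p: "p tagged_partial_division_of {a..b}"
    and U: "\<And>x K. (x, K) \<in> p \<Longrightarrow> K \<subseteq> U" "U \<in> lmeasurable" "measure lebesgue U < d"
  shows "(\<Sum>(x, K)\<in>p. norm (r (Sup K) - r (Inf K))) < e"
proof -
  note p_un = tagged_partial_division_of_Union_self[OF p]
  note div = division_of_tagged_division[OF p_un]
  note pD = tagged_partial_division_ofD[OF p]
  define Q where "Q = {K \<in> snd ` p. Inf K < Sup K}"
  have "finite (snd ` p)"
    using pD(1) by simp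
  then have finQ: "finite Q"
    by (simp add: Q_def)
  have cbox: "\<exists>s t. K = {s..t} \<and> s \<le> t \<and> Inf K = s \<and> Sup K = t \<and> a \<le> s \<and> t \<le> b"
    if "K \<in> snd ` p" for K
  proof -
    obtain x where x: "(x, K) \<in> p"
      using \<open>K \<in> snd ` p\<close> by force
    obtain s t where st: "K = {s..t}"
      using pD(4)[OF x] by auto
    then have "s \<le> t"
      using pD(2)[OF x] by auto
    then show ?thesis
      using st pD(3)[OF x] by auto
  qed
  define I where "I = (\<lambda>K. (Inf K, Sup K)) ` Q"
  have inj: "inj_on (\<lambda>K. (Inf K, Sup K)) Q"
  proof (rule inj_onI)
    fix K L assume "K \<in> Q" "L \<in> Q" "(Inf K, Sup K) = (Inf L, Sup L)"
    then show "K = L"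
      using cbox[of K] cbox[of L] by (auto simp: Q_def)
  qed
  \<comment> \<open>The value at the empty interval is forced to be 0, since \<open>Sup {}\<close> and \<open>Inf {}\<close> are
    unspecified reals.\<close>
  define F where "F = (\<lambda>K. if K = {} then 0 else norm (r (Sup K) - r (Inf K)))"
  have F: "F K = norm (r (Sup K) - r (Inf K))" if "K \<in> snd ` p" for K
    using cbox[OF that] by (auto simp: F_def)
  have "(\<Sum>(x, K)\<in>p. norm (r (Sup K) - r (Inf K))) = (\<Sum>(x, K)\<in>p. F K)"
    using F by (intro sum.cong) force+
  also have "\<dots> = (\<Sum>K\<in>snd ` p. F K)"
  proof (rule sum.over_tagged_division_lemma[OF p_un])
    fix u v :: real
    assume "box u v = {}"
    then show "F (cbox u v) = 0"
      by (cases "u = v") (auto simp: F_def not_less)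
  qed
  also have "\<dots> = (\<Sum>K\<in>snd ` p. norm (r (Sup K) - r (Inf K)))"
    using F by (rule sum.cong[OF refl])
  also have "\<dots> = (\<Sum>K\<in>Q. norm (r (Sup K) - r (Inf K)))"
  proof (rule sum.mono_neutral_right)
    show "\<forall>K\<in>snd ` p - Q. norm (r (Sup K) - r (Inf K)) = 0"
    proof
      fix K assume K: "K \<in> snd ` p - Q"
      then have "Sup K = Inf K"
        using cbox[of K] by (auto simp: Q_def)
      then show "norm (r (Sup K) - r (Inf K)) = 0"
        by simp
    qed
  qed (use pD(1) in \<open>auto simp: Q_def\<close>)
  also have "\<dots> = (\<Sum>(s, t)\<in>I. norm (r t - r s))"
    unfolding I_def by (simp add: sum.reindex[OF inj])
  also have "\<dots> < e"
  proof (rule AC)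
    have "finite I"
      using finQ by (simp add: I_def)
    moreover have "\<forall>(s, t)\<in>I. a \<le> s \<and> s < t \<and> t \<le> b"
    proof -
      have "a \<le> Inf K \<and> Inf K < Sup K \<and> Sup K \<le> b" if "K \<in> Q" for K
        using that cbox[of K] by (auto simp: Q_def)
      then show ?thesis
        by (auto simp: I_def)
    qed
    moreover have "pairwise (\<lambda>(s, t) (s', t'). disjnt {s<..<t} {s'<..<t'}) I"
    proof -
      have "disjnt {Inf K<..<Sup K} {Inf L<..<Sup L}" if "K \<in> Q" "L \<in> Q" "K \<noteq> L" for K L
      proof -
        have "interior K \<inter> interior L = {}"
          using that division_ofD(5)[OF div] by (auto simp: Q_def)
        moreover have "interior K = {Inf K<..<Sup K}" if "K \<in> Q" for K
        proof -
          obtain s t where "K = {s..t}" "Inf K = s" "Sup K = t"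
            using \<open>K \<in> Q\<close> cbox[of K] by (auto simp: Q_def)
          then show ?thesis
            by simp
        qed
        ultimately show ?thesis
          using that by (simp add: disjnt_def)
      qed
      then show ?thesis
        by (auto simp: I_def pairwise_def)
    qed
    ultimately show "disjoint_intervals a b I"
      by (simp add: disjoint_intervals_def)
    have "(\<Sum>(s, t)\<in>I. t - s) = (\<Sum>K\<in>Q. Sup K - Inf K)"
      unfolding I_def by (simp add: sum.reindex[OF inj])
    also have "\<dots> = (\<Sum>K\<in>Q. measure lebesgue K)"
    proof (rule sum.cong[OF refl])
      fix K assume "K \<in> Q"
      then obtain s t where "K = {s..t}" "s \<le> t" "Inf K = s" "Sup K = t"
        using cbox[of K] by (auto simp: Q_def)
      then show "Sup K - Inf K = measure lebesgue K"
        by simp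
    qed
    also have "\<dots> \<le> (\<Sum>K\<in>snd ` p. measure lebesgue K)"
      using pD(1) by (intro sum_mono2) (auto simp: Q_def)
    also have "\<dots> = measure lebesgue (\<Union>(snd ` p))"
      using content_division[OF div] by simp
    also have "\<dots> \<le> measure lebesgue U"
    proof (rule measure_mono_fmeasurable)
      show "\<Union>(snd ` p) \<subseteq> U"
        using U(1) by fastforce
      show "\<Union>(snd ` p) \<in> sets lebesgue"
        using lmeasurable_division[OF div] by (rule fmeasurableD)
    qed (rule U)
    also have "\<dots> < d"
      by (rule U)
    finally show "(\<Sum>(s, t)\<in>I. t - s) < d" .
  qed
  finally show ?thesis .
qed

text \<open>
This is the theorem that an absolutely continuous function with derivative 0 almost everywhere is
constant, where absolute continuity of \<open>f\<close> is replaced by local domination by the curve \<open>r\<close>.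
By Cousin's lemma there is a tagged division so fine that intervals with a tag outside the null
set \<open>N\<close> contribute at most \<open>\<epsilon>\<close> times their length, while those with a tag in \<open>N\<close> lie in an
open set of small measure and contribute little by absolute continuity.
\<close>

lemma eq_endpoints_if_ae_zero_derivative:
  fixes r :: "real \<Rightarrow> 'a::real_normed_vector" and f :: "real \<Rightarrow> 'b::real_normed_vector"
  assumes "a \<le> b" and r: "absolutely_continuous_curve a b r" and "negligible N"
    and deriv: "\<And>t. t \<in> {a..b} - N \<Longrightarrow> (f has_vector_derivative 0) (at t within {a..b})"
    and "0 < L"
    and lip: "\<And>t. t \<in> {a..b} \<Longrightarrow>
      \<exists>\<rho>>0. \<forall>s\<in>{a..b} \<inter> ball t \<rho>. \<forall>s'\<in>{a..b} \<inter> ball t \<rho>. norm (f s - f s') \<le> L * norm (r s - r s')"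
  shows "f b = f a"
proof -
  have "norm (f b - f a) \<le> \<epsilon> * (b - a + 1)" if "0 < \<epsilon>" for \<epsilon>
  proof -
    have "0 < \<epsilon> / L"
      using \<open>0 < L\<close> \<open>0 < \<epsilon>\<close> by simp
    then obtain d where "0 < d" and AC: "\<And>I. disjoint_intervals a b I \<Longrightarrow> (\<Sum>(s, t)\<in>I. t - s) < d
     \<Longrightarrow> (\<Sum>(s, t)\<in>I. norm (r t - r s)) < \<epsilon> / L"
      using r unfolding absolutely_continuous_curve_iff by blast
    obtain U where U: "open U" "N \<subseteq> U" "U \<in> lmeasurable" "measure lebesgue U < d"
    proof -
      have N: "N \<in> lmeasurable" "N \<in> null_sets lebesgue"
        using \<open>negligible N\<close> by (simp_all add: negligible_imp_measurable negligible_iff_null_sets[symmetric])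
      obtain U where U: "open U" "N \<subseteq> U" "U - N \<in> lmeasurable" "emeasure lebesgue (U - N) < ennreal d"
        using sets_lebesgue_outer_open[OF fmeasurableD[OF N(1)] \<open>0 < d\<close>] by blast
      have eq: "(U - N) \<union> N = U"
        using U(2) by blast
      have "U \<in> lmeasurable"
        using fmeasurable.Un[OF U(3) N(1)] by (simp only: eq)
      moreover have "measure lebesgue U = measure lebesgue (U - N)"
        using measure_Un_null_set[OF fmeasurableD[OF U(3)] N(2)] by (simp only: eq)
      moreover have "measure lebesgue (U - N) < d"
        using U(3,4) \<open>0 < d\<close> by (simp add: emeasure_eq_measure2 ennreal_less_iff)
      ultimately show ?thesis
        using that U by simp
    qed
    have "\<exists>\<rho>>0. \<forall>s\<in>{a..b} \<inter> ball t \<rho>. norm (f s - f t) \<le> \<epsilon> * norm (s - t)" if t: "t \<in> {a..b} - N" for t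
    proof -
      have "(f has_derivative (\<lambda>x. 0)) (at t within {a..b})"
        using deriv[OF t] by (simp add: has_vector_derivative_def)
      then obtain \<rho> where "0 < \<rho>" "\<forall>s\<in>{a..b}. norm (s - t) < \<rho> \<longrightarrow> norm (f s - f t) \<le> \<epsilon> * norm (s - t)"
        using \<open>0 < \<epsilon>\<close> unfolding has_derivative_within_alt by force
      then show ?thesis
        by (intro exI[of _ \<rho>]) (auto simp: dist_norm norm_minus_commute)
    qed
    then obtain \<rho>1 where \<rho>1: "\<And>t. t \<in> {a..b} - N \<Longrightarrow> 0 < \<rho>1 t"
      "\<And>t s. t \<in> {a..b} - N \<Longrightarrow> s \<in> {a..b} \<inter> ball t (\<rho>1 t) \<Longrightarrow> norm (f s - f t) \<le> \<epsilon> * norm (s - t)"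
      by metis
    have "\<exists>\<rho>>0. ball t \<rho> \<subseteq> U \<and> (\<forall>s\<in>{a..b} \<inter> ball t \<rho>. \<forall>s'\<in>{a..b} \<inter> ball t \<rho>.
        norm (f s - f s') \<le> L * norm (r s - r s'))" if t: "t \<in> {a..b} \<inter> N" for t
    proof -
      obtain \<rho> where \<rho>: "0 < \<rho>" "\<forall>s\<in>{a..b} \<inter> ball t \<rho>. \<forall>s'\<in>{a..b} \<inter> ball t \<rho>.
          norm (f s - f s') \<le> L * norm (r s - r s')"
        using lip t by blast
      obtain \<rho>' where "0 < \<rho>'" "ball t \<rho>' \<subseteq> U"
        using U t open_contains_ball by (metis IntD2 subsetD)
      with \<rho> show ?thesis
        by (intro exI[of _ "min \<rho> \<rho>'"]) auto
    qed
    then obtain \<rho>2 where \<rho>2: "\<And>t. t \<in> {a..b} \<inter> N \<Longrightarrow> 0 < \<rho>2 t"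
      "\<And>t. t \<in> {a..b} \<inter> N \<Longrightarrow> ball t (\<rho>2 t) \<subseteq> U"
      "\<And>t s s'. t \<in> {a..b} \<inter> N \<Longrightarrow> s \<in> {a..b} \<inter> ball t (\<rho>2 t) \<Longrightarrow> s' \<in> {a..b} \<inter> ball t (\<rho>2 t) \<Longrightarrow>
        norm (f s - f s') \<le> L * norm (r s - r s')"
      by metis
    define \<gamma> where "\<gamma> = (\<lambda>t. if t \<in> {a..b} then ball t (if t \<in> N then \<rho>2 t else \<rho>1 t) else ball t 1)"
    have "gauge \<gamma>"
      using \<rho>1(1) \<rho>2(1) by (auto simp: gauge_def \<gamma>_def)
    then obtain p where p: "p tagged_division_of {a..b}" "\<gamma> fine p"
      using fine_division_exists_real by blast
    note pD = tagged_division_ofD[OF p(1)]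
    define p2 where "p2 = {(x, K) \<in> p. x \<in> N}"
    define p1 where "p1 = {(x, K) \<in> p. x \<notin> N}"
    have split: "p = p1 \<union> p2" "p1 \<inter> p2 = {}" "finite p1" "finite p2"
      using pD(1) by (auto simp: p1_def p2_def intro: rev_finite_subset)
    define F where "F = (\<lambda>(x::real, K). f (Sup K) - f (Inf K))"
    have K: "\<exists>s t. K = {s..t} \<and> s \<le> x \<and> x \<le> t \<and> a \<le> s \<and> t \<le> b \<and> s \<in> \<gamma> x \<and> t \<in> \<gamma> x \<and> K \<subseteq> \<gamma> x"
      if xK: "(x, K) \<in> p" for x K
    proof -
      obtain s t where st: "K = {s..t}"
        using pD(4)[OF xK] by auto
      moreover have "x \<in> K" "K \<subseteq> {a..b}" "K \<subseteq> \<gamma> x"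
        using pD(2,3)[OF xK] p(2) xK by (auto simp: fine_def)
      ultimately show ?thesis
        by auto
    qed
    have sum1: "norm (\<Sum>z\<in>p1. F z) \<le> \<epsilon> * (b - a)"
    proof -
      have "norm (F z) \<le> \<epsilon> * measure lborel (snd z)" if z: "z \<in> p1" for z
      proof -
        obtain x K where xK: "z = (x, K)" "(x, K) \<in> p" "x \<notin> N"
          using z by (auto simp: p1_def)
        obtain s t where st: "K = {s..t}" "s \<le> x" "x \<le> t" "a \<le> s" "t \<le> b" "s \<in> \<gamma> x" "t \<in> \<gamma> x"
          using K[OF xK(2)] by blast
        then have "x \<in> {a..b} - N"
          using xK by auto
        note \<rho> = \<rho>1(2)[OF this]
        have "norm (f t - f s) \<le> norm (f t - f x) + norm (f s - f x)"
          using norm_triangle_ineq4[of "f t - f x" "f s - f x"] by simp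
        also have "\<dots> \<le> \<epsilon> * norm (t - x) + \<epsilon> * norm (s - x)"
          using st xK by (intro add_mono \<rho>) (auto simp: \<gamma>_def)
        also have "\<dots> = \<epsilon> * (t - s)"
          using st by (simp add: algebra_simps)
        finally show ?thesis
          using st xK by (simp add: F_def)
      qed
      then have "norm (\<Sum>z\<in>p1. F z) \<le> (\<Sum>z\<in>p1. \<epsilon> * measure lborel (snd z))"
        by (rule sum_norm_le)
      also have "\<dots> \<le> (\<Sum>z\<in>p. \<epsilon> * measure lborel (snd z))"
        using pD(1) split \<open>0 < \<epsilon>\<close> by (intro sum_mono2) auto
      also have "\<dots> = \<epsilon> * (b - a)"
        using additive_content_tagged_division[of p a b] p(1) \<open>a \<le> b\<close>
        by (simp add: sum_distrib_left[symmetric] case_prod_unfold)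
      finally show ?thesis .
    qed
    have sum2: "norm (\<Sum>z\<in>p2. F z) \<le> \<epsilon>"
    proof -
      have "norm (F z) \<le> L * (case z of (x, K) \<Rightarrow> norm (r (Sup K) - r (Inf K)))" if z: "z \<in> p2" for z
      proof -
        obtain x K where xK: "z = (x, K)" "(x, K) \<in> p" "x \<in> N"
          using z by (auto simp: p2_def)
        obtain s t where st: "K = {s..t}" "s \<le> x" "x \<le> t" "a \<le> s" "t \<le> b" "s \<in> \<gamma> x" "t \<in> \<gamma> x"
          using K[OF xK(2)] by blast
        then have "norm (f t - f s) \<le> L * norm (r t - r s)"
          using xK by (intro \<rho>2(3)[of x]) (auto simp: \<gamma>_def)
        then show ?thesis
          using st xK by (simp add: F_def)
      qed
      then have "norm (\<Sum>z\<in>p2. F z) \<le> (\<Sum>z\<in>p2. L * (case z of (x, K) \<Rightarrow> norm (r (Sup K) - r (Inf K))))"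
        by (rule sum_norm_le)
      also have "\<dots> = L * (\<Sum>(x, K)\<in>p2. norm (r (Sup K) - r (Inf K)))"
        by (rule sum_distrib_left[symmetric])
      also have "\<dots> < L * (\<epsilon> / L)"
      proof (intro mult_strict_left_mono \<open>0 < L\<close>)
        show "(\<Sum>(x, K)\<in>p2. norm (r (Sup K) - r (Inf K))) < \<epsilon> / L"
        proof (rule absolutely_continuous_curve_tagged_sum_less[where d = d and U = U])
          show "p2 tagged_partial_division_of {a..b}"
            using p(1) split(1)
            by (auto simp: tagged_division_of_def intro: tagged_partial_division_subset)
          show "T \<subseteq> U" if "(x, T) \<in> p2" for x T
          proof -
            have "(x, T) \<in> p" "x \<in> N"
              using that by (auto simp: p2_def)
            then show ?thesis
              using K[of x T] \<rho>2(2)[of x] by (force simp: \<gamma>_def)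
          qed
        qed (use U AC in auto)
      qed
      finally show ?thesis
        using \<open>0 < L\<close> by simp
    qed
    have "f b - f a = (\<Sum>z\<in>p. F z)"
      unfolding F_def using additive_tagged_division_1[OF \<open>a \<le> b\<close> p(1), of f] by simp
    also have "\<dots> = (\<Sum>z\<in>p1. F z) + (\<Sum>z\<in>p2. F z)"
      using split by (simp add: sum.union_disjoint)
    finally have "norm (f b - f a) \<le> norm (\<Sum>z\<in>p1. F z) + norm (\<Sum>z\<in>p2. F z)"
      by (simp add: norm_triangle_ineq)
    also have "\<dots> \<le> \<epsilon> * (b - a + 1)"
      using sum1 sum2 by (simp add: algebra_simps)
    finally show ?thesis .
  qed
  note small = this
  have "norm (f b - f a) \<le> 0 + e" if "0 < e" for e
  proof -
    have c: "0 < b - a + 1"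
      using \<open>a \<le> b\<close> by simp
    then have "norm (f b - f a) \<le> e / (b - a + 1) * (b - a + 1)"
      using that by (intro small) (rule divide_pos_pos)
    also have "\<dots> = e"
      by (rule nonzero_eq_divide_eq[THEN iffD1, OF less_imp_neq[OF c, symmetric] refl])
    finally show ?thesis
      by simp
  qed
  then have "norm (f b - f a) \<le> 0"
    by (rule field_le_epsilon)
  then show ?thesis
    by simp
qed

text \<open>
Almost everywhere on the curve the chain rule gives the derivative \<open>a\<^sub>i X\<^sub>ie = 0\<close>. The derivative
of \<open>e\<close> is bounded on the compact trace of the curve, hence near each of its points by a common
constant, so \<open>e\<close> is locally Lipschitz there with one constant.
\<close>

lemma constant_along_admissible_curve:
  fixes e :: "real^'n \<Rightarrow> real"
  assumes "open \<Omega>" and e: "C1_on \<Omega> e" and r: "admissible_curve X \<Omega> T r"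
    and zero: "\<And>x i. x \<in> \<Omega> \<Longrightarrow> hderiv (X i) e x = 0"
  shows "e (r T) = e (r 0)"
proof -
  obtain e' where e': "\<And>x. x \<in> \<Omega> \<Longrightarrow> (e has_derivative blinfun_apply (e' x)) (at x)"
    "continuous_on \<Omega> e'"
    using e unfolding C1_on_def by blast
  have T: "0 \<le> T" and AC: "absolutely_continuous_curve 0 T r" and sub: "r ` {0..T} \<subseteq> \<Omega>"
    using r by (auto simp: admissible_curve_def)
  have cont: "continuous_on {0..T} r"
    using AC by (rule absolutely_continuous_curve_imp_continuous_on)
  obtain a where "AE t in lebesgue_on {0..T}.
      (r has_vector_derivative (\<Sum>i\<in>UNIV. a i t *\<^sub>R X i (r t))) (at t within {0..T})"
    using r unfolding admissible_curve_def by (auto elim!: eventually_mono)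
  then have "AE t in lebesgue. t \<in> {0..T} \<longrightarrow>
      (r has_vector_derivative (\<Sum>i\<in>UNIV. a i t *\<^sub>R X i (r t))) (at t within {0..T})"
    by (subst (asm) AE_restrict_space_iff) auto
  then obtain N where N: "negligible N" "\<And>t. t \<in> {0..T} - N \<Longrightarrow>
      (r has_vector_derivative (\<Sum>i\<in>UNIV. a i t *\<^sub>R X i (r t))) (at t within {0..T})"
    by (auto simp: eventually_ae_filter_negligible)
  have "compact (e' ` r ` {0..T})"
    using cont e'(2) sub
    by (intro compact_continuous_image) (auto intro: continuous_on_subset)
  then obtain L where L: "0 < L" "\<And>t. t \<in> {0..T} \<Longrightarrow> norm (e' (r t)) \<le> L"
    by (force dest!: compact_imp_bounded simp: bounded_pos)
  have "(e \<circ> r) T = (e \<circ> r) 0"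
  proof (rule eq_endpoints_if_ae_zero_derivative[OF T AC N(1), of _ "L + 1"])
    fix t assume t: "t \<in> {0..T} - N"
    then have "r t \<in> \<Omega>"
      using sub by auto
    note de = e'(1)[OF this]
    have "e' (r t) (X i (r t)) = 0" for i
      using zero[OF \<open>r t \<in> \<Omega>\<close>, of i] hderiv_has_derivative(2)[OF de, of "X i"] by simp
    then have "e' (r t) (\<Sum>i\<in>UNIV. a i t *\<^sub>R X i (r t)) = 0"
      by (simp add: blinfun.sum_right blinfun.scaleR_right)
    then show "((e \<circ> r) has_vector_derivative 0) (at t within {0..T})"
      using vector_derivative_diff_chain_within[OF N(2)[OF t] has_derivative_at_withinI[OF de]]
      by simp
  next
    fix t assume t: "t \<in> {0..T}"
    then have "r t \<in> \<Omega>"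
      using sub by auto
    have "continuous_on \<Omega> (\<lambda>x. norm (e' x))"
      by (intro continuous_on_norm e')
    then have "open (\<Omega> \<inter> (\<lambda>x. norm (e' x)) -` {..<L + 1})"
      using \<open>open \<Omega>\<close> by (rule continuous_open_preimage) simp
    moreover have "r t \<in> \<Omega> \<inter> (\<lambda>x. norm (e' x)) -` {..<L + 1}"
      using \<open>r t \<in> \<Omega>\<close> L(2)[OF t] by simp
    ultimately obtain R where R: "0 < R" "ball (r t) R \<subseteq> \<Omega> \<inter> (\<lambda>x. norm (e' x)) -` {..<L + 1}"
      using open_contains_ball by blast
    have bound: "norm (e x - e y) \<le> (L + 1) * norm (x - y)" if "x \<in> ball (r t) R" "y \<in> ball (r t) R" for x y
    proof (rule differentiable_bound[OF convex_ball _ _ that])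
      fix z assume "z \<in> ball (r t) R"
      then have "z \<in> \<Omega>" "norm (e' z) < L + 1"
        using R by auto
      then show "(e has_derivative blinfun_apply (e' z)) (at z within ball (r t) R)"
        "onorm (blinfun_apply (e' z)) \<le> L + 1"
        using e'(1) by (auto simp: norm_blinfun.rep_eq intro: has_derivative_at_withinI)
    qed
    obtain \<rho> where "0 < \<rho>" "\<And>s. s \<in> {0..T} \<Longrightarrow> dist s t < \<rho> \<Longrightarrow> dist (r s) (r t) < R"
      using cont t R(1) unfolding continuous_on_iff by blast
    then have "r s \<in> ball (r t) R" if "s \<in> {0..T} \<inter> ball t \<rho>" for s
      using that by (simp add: dist_commute)
    then show "\<exists>\<rho>>0. \<forall>s\<in>{0..T} \<inter> ball t \<rho>. \<forall>s'\<in>{0..T} \<inter> ball t \<rho>.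
        norm ((e \<circ> r) s - (e \<circ> r) s') \<le> (L + 1) * norm (r s - r s')"
      unfolding comp_apply using \<open>0 < \<rho>\<close> bound by blast
  qed (use L in auto)
  then show ?thesis by simp
qed

section \<open>Solutions are minimal\<close>

text \<open>
The two orthogonal terms of the system vanish separately. Independence of the vectors \<open>X\<^sub>iu\<close> then
removes them from the first term and makes the factor \<open>|Xu|\<^sup>2\<close> of the second one nonzero.
\<close>

lemma immersion_solution_splits:
  fixes u :: "real^'n \<Rightarrow> real^'N"
  assumes u: "u \<in> h_immersions X \<Omega>" and sol: "solves_inf_laplace X \<Omega> u" and x: "x \<in> \<Omega>"
  shows "henergy_deriv X u i x = 0" "perp_proj X u x *v hlaplacian X u x = 0"
proof -
  define T where "T = (\<Sum>i\<in>UNIV. henergy_deriv X u i x *\<^sub>R hderiv (X i) u x)"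
  define \<zeta> where "\<zeta> = perp_proj X u x *v hlaplacian X u x"
  have eq: "T + (norm (hgrad X u x))\<^sup>2 *\<^sub>R \<zeta> = 0"
    using sol x by (simp add: solves_inf_laplace_iff T_def \<zeta>_def)
  have "T \<bullet> \<zeta> = 0"
    unfolding T_def \<zeta>_def by (simp add: inner_sum_left perp_proj_works(1))
  moreover have "T \<bullet> (T + (norm (hgrad X u x))\<^sup>2 *\<^sub>R \<zeta>) = 0"
    by (simp add: eq)
  ultimately have T: "T = 0"
    by (simp add: inner_add_right)
  then show "henergy_deriv X u i x = 0"
    using inj_hgrad_imp_eq_0[OF u x, of "\<lambda>i. henergy_deriv X u i x"] by (simp add: T_def)
  have "hgrad X u x \<noteq> 0"
  proof
    assume "hgrad X u x = 0"
    then have "(\<Sum>i\<in>UNIV. 1 *\<^sub>R hderiv (X i) u x) = 0"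
      using hgrad_mult_vec[of X u x "\<chi> i. 1"] by simp
    from inj_hgrad_imp_eq_0[OF u x this] show False by simp
  qed
  then show "perp_proj X u x *v hlaplacian X u x = 0"
    using eq T by (simp add: \<zeta>_def)
qed

lemma solution_norm_hgrad_constant:
  fixes u :: "real^'n \<Rightarrow> real^'N"
  assumes "open \<Omega>" and cc: "carnot_caratheodory X \<Omega>" and u: "u \<in> Gamma2 X \<Omega>"
    and zero: "\<And>x i. x \<in> \<Omega> \<Longrightarrow> henergy_deriv X u i x = 0"
    and "x \<in> \<Omega>" "y \<in> \<Omega>"
  shows "norm (hgrad X u x) = norm (hgrad X u y)"
proof -
  define e where "e = (\<lambda>x. \<Sum>j\<in>UNIV. hderiv (X j) u x \<bullet> hderiv (X j) u x)"
  have U1: "C1_on \<Omega> (hderiv (X j) u)" for j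
    using u by (simp add: Gamma2_def)
  have e1: "C1_on \<Omega> e"
    unfolding e_def by (intro C1_on_sum C1_on_inner U1)
  have "hderiv (X i) e z = 0" if z: "z \<in> \<Omega>" for i z
  proof -
    note D = C1_on_has_derivative[OF U1 z]
    have "(e has_derivative (\<lambda>h. \<Sum>j\<in>UNIV. hderiv (X j) u z \<bullet> frechet_derivative (hderiv (X j) u) (at z) h
        + frechet_derivative (hderiv (X j) u) (at z) h \<bullet> hderiv (X j) u z)) (at z)"
      unfolding e_def by (intro has_derivative_sum has_derivative_inner D)
    from hderiv_has_derivative(2)[OF this, of "X i"]
    have "hderiv (X i) e z = 2 * henergy_deriv X u i z"
      by (simp add: henergy_deriv_def hderiv_has_derivative(2)[OF D] inner_commute sum_distrib_left)
    then show ?thesis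
      using zero[OF z] by simp
  qed
  moreover obtain T r where "admissible_curve X \<Omega> T r" "r 0 = x" "r T = y"
    using cc assms(5,6) unfolding carnot_caratheodory_def by blast
  ultimately have "e y = e x"
    using constant_along_admissible_curve[OF assms(1) e1] by blast
  then have "(norm (hgrad X u x))\<^sup>2 = (norm (hgrad X u y))\<^sup>2"
    by (simp add: norm_hgrad_eq e_def)
  then show ?thesis
    by simp
qed

text \<open>
Rolle's argument: a function vanishing on the boundary has an interior extremum or is zero.
\<close>

lemma Gamma1_0_has_critical_point:
  fixes g :: "real^'n \<Rightarrow> real"
  assumes D: "compact_subdomain D \<Omega>" and g: "g \<in> Gamma1_0 X D"
  obtains x where "x \<in> D" "\<And>i. hderiv (X i) g x = 0"
proof -
  have D': "open D" "D \<noteq> {}" "compact (closure D)"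
    using D by (auto simp: compact_subdomain_def)
  have cont: "continuous_on (closure D) g"
    and bd: "\<And>z. z \<in> closure D \<Longrightarrow> z \<notin> D \<Longrightarrow> g z = 0"
    using g D'(1) by (auto simp: Gamma1_0_def frontier_def interior_open)
  have "\<exists>x\<in>D. (\<forall>y\<in>D. g y \<le> g x) \<or> (\<forall>y\<in>D. g x \<le> g y)"
  proof -
    obtain z where z: "z \<in> D"
      using D' by blast
    obtain M where M: "M \<in> closure D" "\<And>y. y \<in> closure D \<Longrightarrow> g y \<le> g M"
      using continuous_attains_sup[OF D'(3) _ cont] z closure_subset by blast
    obtain m where m: "m \<in> closure D" "\<And>y. y \<in> closure D \<Longrightarrow> g m \<le> g y"
      using continuous_attains_inf[OF D'(3) _ cont] z closure_subset by blast
    have sub: "\<And>y. y \<in> D \<Longrightarrow> y \<in> closure D"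
      using closure_subset by blast
    consider "M \<in> D" | "m \<in> D" | "M \<notin> D" "m \<notin> D" by blast
    then show ?thesis
    proof cases
      case 3
      then have "g y = 0" if "y \<in> D" for y
        using bd M m sub[OF that] by (metis antisym)
      then show ?thesis
        using z by (intro bexI[of _ z]) auto
    qed (use M m sub in blast)+
  qed
  then obtain x where x: "x \<in> D" "(\<forall>y\<in>D. g y \<le> g x) \<or> (\<forall>y\<in>D. g x \<le> g y)"
    by blast
  have "hderiv (X i) g x = 0" for i
    using g x by (intro hderiv_local_extremum[OF D'(1)]) (auto simp: Gamma1_0_def)
  with x that show ?thesis by blast
qed

text \<open>
The norm \<open>|Xu|\<close> is constant, so a competitor whose gradient is at least as large at one point
cannot have smaller energy. For \<open>u + g\<xi>\<close> a critical point of \<open>g\<close> is such a point; for \<open>u + h\<nu>\<close> every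
point is, because the linear term of the energy vanishes together with the normal part of the
Laplacian.
\<close>

lemma solves_imp_minimal_map:
  fixes u :: "real^'n \<Rightarrow> real^'N"
  assumes "open \<Omega>" and cc: "carnot_caratheodory X \<Omega>" and u: "u \<in> Gamma2_im X \<Omega>"
    and sol: "solves_inf_laplace X \<Omega> u"
  shows "h_inf_minimal_map X \<Omega> u"
proof -
  have u2: "u \<in> Gamma2 X \<Omega>" and im: "u \<in> h_immersions X \<Omega>"
    using u by (auto simp: Gamma2_im_def)
  then have u1: "u \<in> Gamma1 X \<Omega>" "u \<in> Gamma1_rk X \<Omega>"
    by (auto simp: Gamma2_def Gamma1_rk_def)
  note zero = immersion_solution_splits[OF im sol]
  have const: "norm (hgrad X u x) = norm (hgrad X u y)" if "x \<in> \<Omega>" "y \<in> \<Omega>" for x y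
    using zero(1) that by (rule solution_norm_hgrad_constant[OF assms(1) cc u2])
  have E_le: "E_inf X u D \<le> E_inf X v D"
    if D: "compact_subdomain D \<Omega>" and v: "v \<in> Gamma1 X D"
      and x: "x \<in> D" "norm (hgrad X u x) \<le> norm (hgrad X v x)" for D x and v :: "real^'n \<Rightarrow> real^'N"
  proof -
    have D': "open D" "D \<subseteq> \<Omega>"
      using D closure_subset by (auto simp: compact_subdomain_def)
    have "E_inf X u D \<le> ereal (norm (hgrad X u x))"
    proof (rule E_inf_le[OF D'(1) Gamma1_mono[OF u1(1) D'(2)]])
      show "norm (hgrad X u y) \<le> norm (hgrad X u x)" if "y \<in> D" for y
        using const[OF subsetD[OF D'(2) that] subsetD[OF D'(2) x(1)]] by simp
    qed
    also have "\<dots> \<le> ereal (norm (hgrad X v x))"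
      using x by simp
    also have "\<dots> \<le> E_inf X v D"
      by (rule norm_hgrad_le_E_inf[OF D'(1) v x(1)])
    finally show ?thesis .
  qed
  have "h_rank_one_absolute_minimal X \<Omega> u"
    unfolding h_rank_one_absolute_minimal_def
  proof (intro conjI u1 allI impI ballI)
    fix D g and \<xi> :: "real^'N"
    assume D: "compact_subdomain D \<Omega>" and g: "g \<in> Gamma1_0 X D"
    have uD: "u \<in> Gamma1 X D"
      using D closure_subset by (intro Gamma1_mono[OF u1(1)]) (auto simp: compact_subdomain_def)
    have gD: "g \<in> Gamma1 X D"
      using g by (rule Gamma1_0_imp_Gamma1)
    have w: "(\<lambda>x. g x *\<^sub>R \<xi>) \<in> Gamma1 X D"
      by (intro Gamma1_scaleR gD Gamma1_const)
    obtain x where x: "x \<in> D" "\<And>i. hderiv (X i) g x = 0"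
      using Gamma1_0_has_critical_point[OF D g] by blast
    have "hderiv (X i) (\<lambda>x. g x *\<^sub>R \<xi>) x = 0" for i
    proof -
      note c = hderiv_has_derivative[OF has_derivative_const]
      have "hderivable (X i) g x"
        using gD x by (simp add: Gamma1_def)
      then show ?thesis
        by (subst hderiv_bilinear(2)[OF bounded_bilinear_scaleR _ c(1)]) (simp_all add: c(2) x)
    qed
    then have "hgrad X (\<lambda>x. u x + g x *\<^sub>R \<xi>) x = hgrad X u x"
      unfolding hgrad_add[OF uD w x(1)] by (simp add: hgrad_def vec_eq_iff)
    then show "E_inf X u D \<le> E_inf X (\<lambda>x. u x + g x *\<^sub>R \<xi>) D"
      by (intro E_le[OF D Gamma1_add[OF uD w] x(1)]) simp
  qed
  moreover have "h_inf_minimal_area X \<Omega> u"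
    unfolding h_inf_minimal_area_def
  proof (intro conjI u1 allI impI ballI)
    fix D h and \<nu> :: "real^'n \<Rightarrow> real^'N"
    assume D: "compact_subdomain D \<Omega>" and h: "h \<in> Gamma1_closure X D"
      and \<nu>: "\<nu> \<in> vertical_fields X u D"
    have D': "open D" "D \<subseteq> \<Omega>"
      using D closure_subset by (auto simp: compact_subdomain_def)
    obtain x where x: "x \<in> D"
      using D by (auto simp: compact_subdomain_def)
    have uD: "u \<in> Gamma1 X D"
      using u1(1) D'(2) by (rule Gamma1_mono)
    have hD: "h \<in> Gamma1 X D"
      using h by (rule Gamma1_closure_imp_Gamma1)
    have \<nu>D: "\<nu> \<in> Gamma1 X D" "\<And>y. y \<in> D \<Longrightarrow> \<exists>\<eta>. \<nu> y = perp_proj X u y *v \<eta>"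
      using \<nu> by (auto simp: vertical_fields_def)
    have vert: "hderiv (X i) u y \<bullet> \<nu> y = 0" if "y \<in> D" for y i
      using \<nu>D(2)[OF that] perp_proj_works(1) by metis
    have "\<nu> x \<bullet> hlaplacian X u x = (perp_proj X u x *v hlaplacian X u x) \<bullet> \<nu> x"
      using perp_proj_works(2)[of X u x "\<nu> x"] vert[OF x] by (simp add: inner_commute)
    also have "\<dots> = 0"
      using zero(2) x D' by auto
    finally have "(norm (hgrad X u x))\<^sup>2 \<le> (norm (hgrad X (\<lambda>x. u x + h x *\<^sub>R \<nu> x) x))\<^sup>2"
      using vertical_variation_energy[OF D' u2 hD \<nu>D(1) vert x] by simp
    then have "norm (hgrad X u x) \<le> norm (hgrad X (\<lambda>x. u x + h x *\<^sub>R \<nu> x) x)"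
      by (rule power2_le_imp_le) simp
    then show "E_inf X u D \<le> E_inf X (\<lambda>x. u x + h x *\<^sub>R \<nu> x) D"
      by (intro E_le[OF D _ x] Gamma1_add Gamma1_scaleR uD hD \<nu>D)
  qed
  ultimately show ?thesis
    by (simp add: h_inf_minimal_map_def)
qed

theorem theorem3p2:
  fixes \<Omega> :: "(real^'n) set"
    and X :: "'m::finite \<Rightarrow> real^'n \<Rightarrow> real^'n"
    and G :: "real^'n \<Rightarrow> real^'n^'n"
    and u :: "real^'n \<Rightarrow> real^'N"
  assumes "CARD('m) \<le> CARD('n)"
    and "open \<Omega>" and "connected \<Omega>"
    and "\<And>i. C1_on \<Omega> (X i)"
    and "riemannian_metric_on \<Omega> G" and "orthonormal_frame_on \<Omega> G X"
    and "u \<in> Gamma2_rk X \<Omega>"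
  shows "(h_inf_minimal_map X \<Omega> u \<longrightarrow> solves_inf_laplace X \<Omega> u) \<and>
         (carnot_caratheodory X \<Omega> \<and> u \<in> Gamma2_im X \<Omega> \<and> solves_inf_laplace X \<Omega> u
            \<longrightarrow> h_inf_minimal_map X \<Omega> u)"
  using minimal_map_imp_solves[OF assms(2,4,7)] solves_imp_minimal_map[OF assms(2)] by blast

end
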